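(* Let $H_n$ be the number of distinct fringe subtrees (distinct as plane trees, labels removed) in a random plane-oriented recursive tree of size $n$. For $c_{13}=\frac{\log2}{2}+\sum_{k\ge1}\frac{\log k}{(2k+1)(2k-1)}\approx0.5854804841$ and $c_{14}=\log2$: (i) $\frac{c_{13}n}{\log n}(1+o(1))\le\mathbb{E}(H_n)\le\frac{c_{14}n}{\log n}(1+o(1))$; (ii) with probability tending to $1$, $\frac{c_{13}n}{\log n}(1+o(1))\le H_n\le\frac{c_{14}n}{\log n}(1+o(1))$.
   Context: A plane-oriented recursive tree of size $n$ is a plane (ordered) rooted tree with vertices labelled $1,\dots,n$ increasingly along paths from the root; a random one is chosen uniformly (equivalently, vertex $j$ attaches to an earlier vertex with probability proportional to $1+$ its current number of children). A fringe subtree is a vertex with all descendants. *)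

theory Defs
  imports "HOL-Probability.Probability" "HOL-Library.Landau_Symbols" "HOL-Real_Asymp.Real_Asymp"
begin

text \<open>Nonempty plane (ordered) rooted trees with vertex labels; unlabelled plane trees are
  the instance with labels of type \<^typ>\<open>unit\<close>.\<close>

datatype 'a ptree = Node (root_label: 'a) (children: "'a ptree list")

primrec labels :: "'a ptree \<Rightarrow> 'a list" where
  "labels (Node a ts) = a # concat (map labels ts)"

fun increasing_tree :: "nat ptree \<Rightarrow> bool" where
  "increasing_tree (Node a ts) \<longleftrightarrow> (\<forall>t\<in>set ts. a < root_label t \<and> increasing_tree t)"

definition PORTs :: "nat \<Rightarrow> nat ptree set" where
  "PORTs n = {t. distinct (labels t) \<and> set (labels t) = {1..n} \<and> increasing_tree t}"

definition random_PORT :: "nat \<Rightarrow> nat ptree pmf" where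
  "random_PORT n = pmf_of_set (PORTs n)"

primrec fringe_subtrees :: "'a ptree \<Rightarrow> 'a ptree set" where
  "fringe_subtrees (Node a ts) = insert (Node a ts) (\<Union> (set (map fringe_subtrees ts)))"

definition shape :: "'a ptree \<Rightarrow> unit ptree" where
  "shape = map_ptree (\<lambda>_. ())"

definition num_distinct_fringe :: "'a ptree \<Rightarrow> nat" where
  "num_distinct_fringe t = card (shape ` fringe_subtrees t)"

definition c13 :: real where
  "c13 = ln 2 / 2 + (\<Sum>j. let k = real (Suc j) in ln k / ((2 * k + 1) * (2 * k - 1)))"

definition c14 :: real where
  "c14 = ln 2"

text \<open>The totalised operators used above (\<^const>\<open>suminf\<close>, \<^const>\<open>card\<close>,
  \<^const>\<open>pmf_of_set\<close>) have their intended meaning:\<close>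

lemma summable_c13: "summable (\<lambda>j. let k = real (Suc j) in ln k / ((2 * k + 1) * (2 * k - 1)))"
proof (rule summable_comparison_test_bigo)
  show "summable (\<lambda>j. norm (real j powr (-3/2)))"
    by (simp add: summable_real_powr_iff)
  show "(\<lambda>j. let k = real (Suc j) in ln k / ((2 * k + 1) * (2 * k - 1))) \<in> O(\<lambda>j. real j powr (-3/2))"
    unfolding Let_def by real_asymp
qed

lemma finite_fringe_subtrees: "finite (fringe_subtrees t)"
  by (induction t) auto

lemma finite_ptrees:
  assumes "finite A"
  shows "finite {t. set (labels t) \<subseteq> A \<and> length (labels t) \<le> m}"
proof (induction m)
  case 0
  have "{t. set (labels t) \<subseteq> A \<and> length (labels t) \<le> 0} = {}"
  proof -
    have "labels t \<noteq> []" for t :: "'a ptree" by (cases t) simp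
    then show ?thesis by simp
  qed
  then show ?case by (simp only: finite.emptyI)
next
  case (Suc m)
  let ?S = "{t. set (labels t) \<subseteq> A \<and> length (labels t) \<le> m}"
  have pos: "1 \<le> length (labels t)" for t :: "'a ptree"
    by (cases t) simp
  have "{t. set (labels t) \<subseteq> A \<and> length (labels t) \<le> Suc m}
      \<subseteq> (\<lambda>(a, ts). Node a ts) ` (A \<times> {ts. set ts \<subseteq> ?S \<and> length ts \<le> m})"
  proof
    fix t assume t: "t \<in> {t. set (labels t) \<subseteq> A \<and> length (labels t) \<le> Suc m}"
    obtain a ts where [simp]: "t = Node a ts" by (cases t)
    have *: "(\<Sum>x\<leftarrow>ts. length (labels x)) \<le> m"
      using t by (simp add: length_concat o_def)
    have "length (labels x) \<le> m" if "x \<in> set ts" for x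
      using * member_le_sum_list[of "length (labels x)" "map (\<lambda>x. length (labels x)) ts"] that
      by force
    moreover have "length ts \<le> (\<Sum>x\<leftarrow>ts. length (labels x))"
      using sum_list_mono[of ts "\<lambda>_. 1" "\<lambda>x. length (labels x)"] pos
      by (simp add: sum_list_triv)
    ultimately have "(a, ts) \<in> A \<times> {ts. set ts \<subseteq> ?S \<and> length ts \<le> m}"
      using t * by auto
    then show "t \<in> (\<lambda>(a, ts). Node a ts) ` (A \<times> {ts. set ts \<subseteq> ?S \<and> length ts \<le> m})"
      by force
  qed
  moreover have "finite (A \<times> {ts. set ts \<subseteq> ?S \<and> length ts \<le> m})"
    using finite_lists_length_le[OF Suc.IH] assms by blast
  ultimately show ?case
    by (meson finite_imageI finite_subset)
qed

lemma finite_PORTs: "finite (PORTs n)"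
proof (rule finite_subset)
  show "PORTs n \<subseteq> {t. set (labels t) \<subseteq> {1..n} \<and> length (labels t) \<le> n}"
    by (auto simp: PORTs_def dest: distinct_card)
qed (rule finite_ptrees, simp)

lemma PORTs_nonempty:
  assumes "n \<ge> 1"
  shows "PORTs n \<noteq> {}"
proof -
  have [simp]: "concat (map (labels \<circ> (\<lambda>k. Node k [])) xs) = xs" for xs :: "nat list"
    by (induction xs) auto
  have "Node 1 (map (\<lambda>k. Node k []) [2..<Suc n]) \<in> PORTs n"
    using assms by (auto simp: PORTs_def)
  then show ?thesis by blast
qed

end

theory Submission
  imports Defs
begin

text \<open>
  Plane-oriented recursive trees grow by inserting a leaf into one of the \<open>2 * n - 1\<close> slots of a
  tree of size \<open>n\<close>. Along this chain the number \<open>Y\<close> of fringe subtrees of size at least \<open>k\<close> has mean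
  \<open>1 / 2 + (2 * n - 1) / (2 * (2 * k - 1))\<close>, and since one step adds a Bernoulli variable and mixes
  consecutive counts convexly, its variance is at most \<open>n / 4\<close>.

  Upper bound: there are at most \<open>2 * 4 ^ k\<close> shapes of size less than \<open>k\<close>, hence at most \<open>2 * 4 ^ k + Y\<close>
  distinct fringe subtrees; take \<open>k\<close> slightly below \<open>ln n / ln 4\<close>.

  Lower bound: by the hook length formula the probability of a shape of size \<open>k\<close> is, up to a
  polynomial factor, \<open>2 ^ (- k)\<close> times the inverse product of all its fringe subtree sizes. The logarithm
  of that product is a positive combination of the counts above, so it concentrates, and a typical
  shape has probability about \<open>exp (- 2 * c13 * k)\<close>. Two disjoint fringe subtrees are independent given
  their sizes, so for \<open>k\<close> slightly above \<open>ln n / (2 * c13)\<close> coinciding pairs of typical fringe subtrees of size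
  at least \<open>k\<close> are negligible compared with \<open>Y\<close>.
\<close>

section \<open>Growing a tree by leaf insertions\<close>

text \<open>A vertex with \<open>d\<close> children offers \<open>d + 1\<close> slots, exactly its
  attachment weight, and the numbers of children in a tree of size \<open>n\<close> add up to
  \<open>n - 1\<close>; hence the \<open>2 * n - 1\<close> slots. Both constants come from one
  formula: about \<open>n / (2 * b * ln n)\<close> fringe subtrees have size at least
  \<open>b * ln n\<close>. Two exponential rates fix \<open>b\<close>. The number of shapes of size
  less than \<open>k\<close> is at most of order \<open>exp (k * ln 4)\<close>, and
  \<open>b = 1 / ln 4\<close> turns the formula into \<open>ln 2 * n / ln n\<close>. A typical shape
  has probability about \<open>exp (- 2 * c13 * k)\<close>, so among at most \<open>n^2\<close>
  pairs the coincidences become rarer than \<open>n / ln n\<close> once \<open>k\<close> exceeds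
  \<open>ln n / (2 * c13)\<close>, which gives \<open>c13 * n / ln n\<close>. Between the two
  thresholds neither argument applies, hence the gap between \<open>c13\<close> and
  \<open>c14\<close>. The obstacle is dependence: fringe subtrees overlap and their sizes are
  random. It is met by working only with finite averages and with exact identities for one
  insertion, so that neither conditional distributions nor covariances of counts are ever
  formed.\<close>

fun forest_size :: "'a ptree list \<Rightarrow> nat" where
  "forest_size [] = 0"
| "forest_size (Node a us # ts) = Suc (forest_size us + forest_size ts)"

text \<open>First-child/next-sibling recursion: a forest splits into the children of its first root
  and the remaining roots. Both induction hypotheses then concern forests, and no nested induction
  over lists of children is needed.\<close>

lemmas forest_induct [case_names Nil Cons] = forest_size.induct

text \<open>A forest with \<open>m\<close> vertices has \<open>2 * m + 1\<close> slots for a new leaf; the head of the list is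
  the slot to the left of the first root, the rest are the slots below it and to its right.\<close>

fun leaf_insertions :: "'a \<Rightarrow> 'a ptree list \<Rightarrow> 'a ptree list list" where
  "leaf_insertions x [] = [[Node x []]]"
| "leaf_insertions x (Node a us # ts) =
     (Node x [] # Node a us # ts)
     # map (\<lambda>vs. Node a vs # ts) (leaf_insertions x us)
     @ map (\<lambda>vs. Node a us # vs) (leaf_insertions x ts)"

fun tree_insertions :: "'a \<Rightarrow> 'a ptree \<Rightarrow> 'a ptree list" where
  "tree_insertions x (Node a us) = map (Node a) (leaf_insertions x us)"

text \<open>When \<open>x\<close> is found its children disappear with it. This is harmless because
  it is used only where that vertex is a leaf: for the largest label of an increasing forest, or for
  a label just inserted.\<close>

fun delete_label :: "'a \<Rightarrow> 'a ptree list \<Rightarrow> 'a ptree list" where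
  "delete_label x [] = []"
| "delete_label x (Node a us # ts) =
     (if a = x then ts else Node a (delete_label x us) # delete_label x ts)"

definition forest_labels :: "'a ptree list \<Rightarrow> 'a list" where
  "forest_labels ts = concat (map labels ts)"

lemma forest_labels_simps [simp]:
  "forest_labels [] = []"
  "forest_labels (Node a us # ts) = a # forest_labels us @ forest_labels ts"
  by (simp_all add: forest_labels_def)

lemma labels_Node: "labels (Node a us) = a # forest_labels us"
  by (simp add: forest_labels_def)

lemma length_forest_labels: "length (forest_labels ts) = forest_size ts"
  by (induction ts rule: forest_induct) auto

definition increasing_forest :: "nat \<Rightarrow> nat ptree list \<Rightarrow> bool" where
  "increasing_forest a ts \<longleftrightarrow> (\<forall>t\<in>set ts. a < root_label t \<and> increasing_tree t)"

lemma increasing_forest_simps [simp]: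
  "increasing_forest a []"
  "increasing_forest a (Node b us # ts) \<longleftrightarrow> a < b \<and> increasing_forest b us \<and> increasing_forest a ts"
  by (auto simp: increasing_forest_def)

lemma increasing_tree_Node: "increasing_tree (Node a us) \<longleftrightarrow> increasing_forest a us"
  by (simp add: increasing_forest_def)

lemma length_leaf_insertions: "length (leaf_insertions x ts) = 2 * forest_size ts + 1"
  by (induction ts rule: forest_induct) auto

lemma forest_size_leaf_insertions:
  "vs \<in> set (leaf_insertions x ts) \<Longrightarrow> forest_size vs = Suc (forest_size ts)"
  by (induction ts arbitrary: vs rule: forest_induct) auto

lemma delete_label_absent: "x \<notin> set (forest_labels ts) \<Longrightarrow> delete_label x ts = ts"
  by (induction ts rule: forest_induct) auto

lemma delete_label_leaf_insertions:
  assumes "x \<notin> set (forest_labels ts)" "vs \<in> set (leaf_insertions x ts)"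
  shows "delete_label x vs = ts"
  using assms
  by (induction ts arbitrary: vs rule: forest_induct) (auto simp: delete_label_absent)

lemma mset_forest_labels_leaf_insertions:
  "vs \<in> set (leaf_insertions x ts) \<Longrightarrow>
   mset (forest_labels vs) = add_mset x (mset (forest_labels ts))"
  by (induction ts arbitrary: vs rule: forest_induct) auto

lemma increasing_forest_leaf_insertions_iff:
  assumes "vs \<in> set (leaf_insertions m ts)" "\<forall>x\<in>set (forest_labels ts). x < m" "a < m"
  shows "increasing_forest a vs \<longleftrightarrow> increasing_forest a ts"
  using assms
  by (induction ts arbitrary: vs a rule: forest_induct) auto

lemma distinct_leaf_insertions:
  assumes "x \<notin> set (forest_labels ts)"
  shows "distinct (leaf_insertions x ts)"
  using assms
proof (induction ts rule: forest_induct)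
  case (Cons a us ts)
  \<comment> \<open>An overlap of the two mapped lists would make \<open>us\<close> an insertion
    into itself, which its size forbids.\<close>
  have "us \<notin> set (leaf_insertions x us)"
    using forest_size_leaf_insertions[of us x us] by auto
  then show ?case
    using Cons by (auto simp: distinct_map inj_on_def)
qed simp

lemma Cons_leaf_in_leaf_insertions: "Node x [] # ts \<in> set (leaf_insertions x ts)"
  by (cases ts rule: forest_size.cases) auto

text \<open>In an increasing forest the vertex with the largest label has no children, so its
  removal leaves behind precisely the slot it occupied.\<close>

lemma leaf_insertions_delete_label:
  assumes "increasing_forest a ts" "m \<in> set (forest_labels ts)" "distinct (forest_labels ts)"
    "\<forall>x\<in>set (forest_labels ts). x \<le> m"
  shows "ts \<in> set (leaf_insertions m (delete_label m ts))"
  using assms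
proof (induction ts arbitrary: a rule: forest_induct)
  case (Cons b us ts)
  show ?case
  proof (cases "b = m")
    case True
    have "us = []"
      using Cons.prems True by (cases us rule: forest_size.cases) auto
    then show ?thesis
      using True Cons_leaf_in_leaf_insertions by simp
  next
    case False
    then consider "m \<in> set (forest_labels us)" "m \<notin> set (forest_labels ts)"
      | "m \<in> set (forest_labels ts)" "m \<notin> set (forest_labels us)"
      using Cons.prems by auto
    then show ?thesis
    proof cases
      case 1
      have "us \<in> set (leaf_insertions m (delete_label m us))"
        using Cons.IH(1)[of b] Cons.prems 1 by auto
      then show ?thesis
        using False 1 by (auto simp: delete_label_absent)
    next
      case 2
      have "ts \<in> set (leaf_insertions m (delete_label m ts))"
        using Cons.IH(2)[of a] Cons.prems 2 by auto
      then show ?thesis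
        using False 2 by (auto simp: delete_label_absent)
    qed
  qed
qed simp

section \<open>Labelled trees of size n + 1 as leaf insertions\<close>

lemma PORTs_iff:
  "Node a us \<in> PORTs n \<longleftrightarrow>
     mset (a # forest_labels us) = mset_set {1..n} \<and> increasing_forest a us"
proof -
  \<comment> \<open>Both conditions on the labels become one multiset equation, which an insertion
    changes only by one added element.\<close>
  have "distinct xs \<and> set xs = A \<longleftrightarrow> mset xs = mset_set A" if "finite A" for xs and A :: "nat set"
  proof -
    have "mset xs = mset_set A \<Longrightarrow> distinct xs \<and> set xs = A"
      using that mset_eq_imp_distinct_iff[of xs "sorted_list_of_set A"]
        mset_eq_setD[of xs "sorted_list_of_set A"] mset_sorted_list_of_multiset[of "mset_set A"]
      by (auto simp only: sorted_list_of_mset_set distinct_sorted_list_of_set set_sorted_list_of_set)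
    then show ?thesis
      using mset_set_set[of xs] by auto
  qed
  then show ?thesis
    by (simp only: PORTs_def mem_Collect_eq labels_Node increasing_tree_Node conj_assoc[symmetric]
        finite_atLeastAtMost)
qed


lemma PORTs_Suc:
  assumes "n \<ge> 1"
  shows "PORTs (Suc n) = (\<Union>t\<in>PORTs n. set (tree_insertions (Suc n) t))"
proof (intro equalityI subsetI)
  fix t assume t: "t \<in> PORTs (Suc n)"
  obtain a vs where [simp]: "t = Node a vs" by (cases t)
  have lab: "mset (a # forest_labels vs) = mset_set {1..Suc n}" and inc: "increasing_forest a vs"
    using t by (auto simp only: PORTs_iff \<open>t = Node a vs\<close>)
  have dist: "distinct (a # forest_labels vs)" and set: "set (a # forest_labels vs) = {1..Suc n}"
    using t by (auto simp: PORTs_def labels_Node simp del: labels.simps)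
  have "a \<noteq> Suc n"
  proof
    assume "a = Suc n"
    have "vs = []"
    proof (cases vs rule: forest_size.cases)
      case (2 b us ts)
      then have "b \<in> {1..Suc n}"
        unfolding set[symmetric] by simp
      then show ?thesis
        using inc 2 \<open>a = Suc n\<close> by simp
    qed simp
    then have "{1..Suc n} = {Suc n}"
      using set \<open>a = Suc n\<close> by simp
    moreover have "1 \<in> {1..Suc n}" by simp
    ultimately show False
      using assms by auto
  qed
  then have "Suc n \<in> set (forest_labels vs)"
    using set by auto
  moreover have "\<forall>x\<in>set (forest_labels vs). x \<le> Suc n"
    using set by auto
  moreover define us where "us = delete_label (Suc n) vs"
  ultimately have ins: "vs \<in> set (leaf_insertions (Suc n) us)"
    using leaf_insertions_delete_label[of a vs "Suc n"] inc dist by simp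
  have mset: "mset (forest_labels vs) = add_mset (Suc n) (mset (forest_labels us))"
    by (rule mset_forest_labels_leaf_insertions[OF ins])
  then have lab': "mset (a # forest_labels us) = mset_set {1..n}"
    using lab by (simp add: atLeastAtMostSuc_conv add_mset_commute)
  have "set (a # forest_labels us) = {1..n}"
    using arg_cong[OF lab', of set_mset] by simp
  then have "\<forall>x\<in>set (a # forest_labels us). x < Suc n"
    by (simp only:) simp
  then have "\<forall>x\<in>set (forest_labels us). x < Suc n" "a < Suc n"
    by simp_all
  then have "increasing_forest a us"
    using increasing_forest_leaf_insertions_iff[OF ins] inc by simp
  then have "Node a us \<in> PORTs n"
    using lab' by (simp only: PORTs_iff)
  then show "t \<in> (\<Union>t\<in>PORTs n. set (tree_insertions (Suc n) t))"
    using ins by (intro UN_I[of "Node a us"]) auto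
next
  fix t assume "t \<in> (\<Union>t\<in>PORTs n. set (tree_insertions (Suc n) t))"
  then obtain s where s: "s \<in> PORTs n" "t \<in> set (tree_insertions (Suc n) s)" by blast
  obtain a us where [simp]: "s = Node a us" by (cases s)
  obtain vs where vs: "t = Node a vs" "vs \<in> set (leaf_insertions (Suc n) us)"
    using s by auto
  have lab: "mset (a # forest_labels us) = mset_set {1..n}" and inc: "increasing_forest a us"
    using s by (auto simp only: PORTs_iff \<open>s = Node a us\<close>)
  have "set (a # forest_labels us) = {1..n}"
    using arg_cong[OF lab, of set_mset] by simp
  then have "\<forall>x\<in>set (a # forest_labels us). x < Suc n"
    by (simp only:) simp
  then have "\<forall>x\<in>set (forest_labels us). x < Suc n" "a < Suc n"
    by simp_all
  then have "increasing_forest a vs"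
    using increasing_forest_leaf_insertions_iff[OF vs(2)] inc by simp
  moreover have "mset (a # forest_labels vs) = mset_set {1..Suc n}"
    using lab mset_forest_labels_leaf_insertions[OF vs(2)]
    by (simp add: atLeastAtMostSuc_conv add_mset_commute)
  ultimately show "t \<in> PORTs (Suc n)"
    by (simp only: PORTs_iff vs)
qed

lemma Suc_notin_labels_PORTs: "Node a us \<in> PORTs n \<Longrightarrow> Suc n \<notin> set (forest_labels us) \<and> a \<noteq> Suc n"
proof -
  assume "Node a us \<in> PORTs n"
  then have "set (labels (Node a us)) = {1..n}"
    by (simp only: PORTs_def mem_Collect_eq)
  then have "Suc n \<notin> set (labels (Node a us))"
    by (simp only:) simp
  then show ?thesis
    by (simp add: labels_Node del: labels.simps)
qed

text \<open>Deleting \<open>Suc n\<close> recovers the smaller tree, and different slots give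
  different trees, so nothing is counted twice. Labels matter here: on shapes two slots may give the
  same result, which is why insertions are kept as lists with multiplicity.\<close>

lemma sum_PORTs_Suc:
  fixes \<phi> :: "nat ptree \<Rightarrow> real"
  assumes "n \<ge> 1"
  shows "(\<Sum>t\<in>PORTs (Suc n). \<phi> t) = (\<Sum>t\<in>PORTs n. \<Sum>s\<leftarrow>tree_insertions (Suc n) t. \<phi> s)"
proof -
  have del: "delete_label (Suc n) [s] = [t]" if "t \<in> PORTs n" "s \<in> set (tree_insertions (Suc n) t)" for s t
    using that delete_label_leaf_insertions Suc_notin_labels_PORTs
    by (cases t) fastforce
  have "\<forall>t\<in>PORTs n. \<forall>t'\<in>PORTs n. t \<noteq> t' \<longrightarrow>
      set (tree_insertions (Suc n) t) \<inter> set (tree_insertions (Suc n) t') = {}"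
  proof (intro ballI impI equals0I)
    fix t t' s assume "t \<in> PORTs n" "t' \<in> PORTs n" "t \<noteq> t'"
      "s \<in> set (tree_insertions (Suc n) t) \<inter> set (tree_insertions (Suc n) t')"
    then show False
      using del[of t s] del[of t' s] by simp
  qed
  then have "(\<Sum>t\<in>PORTs (Suc n). \<phi> t) = (\<Sum>t\<in>PORTs n. \<Sum>s\<in>set (tree_insertions (Suc n) t). \<phi> s)"
    unfolding PORTs_Suc[OF assms] by (intro sum.UNION_disjoint finite_PORTs) auto
  also have "\<dots> = (\<Sum>t\<in>PORTs n. \<Sum>s\<leftarrow>tree_insertions (Suc n) t. \<phi> s)"
  proof (rule sum.cong)
    fix t assume t: "t \<in> PORTs n"
    obtain a us where [simp]: "t = Node a us" by (cases t)
    have "distinct (tree_insertions (Suc n) t)"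
      using distinct_leaf_insertions[of "Suc n" us] Suc_notin_labels_PORTs[of a us n] t
      by (auto simp: distinct_map inj_on_def)
    then show "(\<Sum>s\<in>set (tree_insertions (Suc n) t). \<phi> s) = (\<Sum>s\<leftarrow>tree_insertions (Suc n) t. \<phi> s)"
      by (simp only: sum_list_distinct_conv_sum_set)
  qed simp
  finally show ?thesis .
qed

section \<open>Shapes and averages over them\<close>

lemma shape_Node [simp]: "shape (Node a us) = Node () (map shape us)"
  by (simp add: shape_def)

text \<open>Slots do not depend on labels, so the growth chain descends to shapes; as an equality of
  lists it preserves multiplicities.\<close>

lemma map_shape_leaf_insertions:
  "map (map shape) (leaf_insertions x ts) = leaf_insertions () (map shape ts)"
proof (induction ts rule: forest_induct)
  case (Cons a us ts)
  have "map (map shape) (leaf_insertions x (Node a us # ts)) =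
     (Node () [] # Node () (map shape us) # map shape ts)
     # map (\<lambda>vs. Node () vs # map shape ts) (map (map shape) (leaf_insertions x us))
     @ map (\<lambda>vs. Node () (map shape us) # vs) (map (map shape) (leaf_insertions x ts))"
    by (simp add: o_def)
  also have "\<dots> = leaf_insertions () (map shape (Node a us # ts))"
    unfolding Cons.IH by simp
  finally show ?case .
qed simp

lemma map_shape_tree_insertions: "map shape (tree_insertions x t) = tree_insertions () (shape t)"
proof (cases t)
  case (Node a us)
  have "map shape (tree_insertions x t) = map (Node ()) (map (map shape) (leaf_insertions x us))"
    by (simp add: Node o_def)
  then show ?thesis
    by (simp add: map_shape_leaf_insertions Node)
qed

abbreviation tree_size :: "'a ptree \<Rightarrow> nat" where
  "tree_size t \<equiv> forest_size [t]"

lemma forest_size_map_shape: "forest_size (map shape ts) = forest_size ts"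
  by (induction ts rule: forest_induct) auto

lemma tree_size_shape: "tree_size (shape t) = tree_size t"
  using forest_size_map_shape[of "[t]"] by simp

lemma tree_size_PORTs:
  assumes "t \<in> PORTs n"
  shows "tree_size t = n"
proof -
  have "length (labels t) = card {1..n}"
    using assms distinct_card[of "labels t"] by (simp add: PORTs_def)
  then show ?thesis
    using length_forest_labels[of "[t]"] by (simp add: forest_labels_def)
qed

text \<open>A finite average, so linearity needs no integrability. \<open>PORTs 0\<close> is empty,
  so the value at \<open>n = 0\<close> is 0; constants are reproduced only for
  \<open>n >= 1\<close>.\<close>

definition PORT_mean :: "nat \<Rightarrow> (unit ptree \<Rightarrow> real) \<Rightarrow> real" where
  "PORT_mean n \<phi> = (\<Sum>t\<in>PORTs n. \<phi> (shape t)) / real (card (PORTs n))"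

lemma PORT_mean_add: "PORT_mean n (\<lambda>s. \<phi> s + \<psi> s) = PORT_mean n \<phi> + PORT_mean n \<psi>"
  by (simp add: PORT_mean_def sum.distrib add_divide_distrib)

lemma PORT_mean_diff: "PORT_mean n (\<lambda>s. \<phi> s - \<psi> s) = PORT_mean n \<phi> - PORT_mean n \<psi>"
  by (simp add: PORT_mean_def sum_subtractf diff_divide_distrib)

lemma PORT_mean_cmult: "PORT_mean n (\<lambda>s. c * \<phi> s) = c * PORT_mean n \<phi>"
  by (simp add: PORT_mean_def sum_distrib_left)

lemma PORT_mean_sum: "PORT_mean n (\<lambda>s. \<Sum>i\<in>I. \<phi> i s) = (\<Sum>i\<in>I. PORT_mean n (\<phi> i))"
  unfolding PORT_mean_def sum.swap[of _ I] sum_divide_distrib ..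

lemma PORT_mean_cong:
  assumes "\<And>s. tree_size s = n \<Longrightarrow> \<phi> s = \<psi> s"
  shows "PORT_mean n \<phi> = PORT_mean n \<psi>"
proof -
  have "(\<Sum>t\<in>PORTs n. \<phi> (shape t)) = (\<Sum>t\<in>PORTs n. \<psi> (shape t))"
    by (intro sum.cong refl assms) (simp only: tree_size_shape tree_size_PORTs)
  then show ?thesis
    by (simp only: PORT_mean_def)
qed

lemma PORT_mean_mono:
  assumes "\<And>s. tree_size s = n \<Longrightarrow> \<phi> s \<le> \<psi> s"
  shows "PORT_mean n \<phi> \<le> PORT_mean n \<psi>"
  unfolding PORT_mean_def
  by (intro divide_right_mono sum_mono assms) (simp_all only: tree_size_shape tree_size_PORTs of_nat_0_le_iff)

lemma PORT_mean_const: "n \<ge> 1 \<Longrightarrow> PORT_mean n (\<lambda>_. c) = c"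
  using PORTs_nonempty[of n] finite_PORTs[of n] by (simp add: PORT_mean_def)

lemma length_tree_insertions: "length (tree_insertions x t) = 2 * tree_size t - 1"
  by (cases t) (simp add: length_leaf_insertions)

lemma PORT_mean_Suc:
  assumes "n \<ge> 1"
  shows "PORT_mean (Suc n) \<phi> =
    PORT_mean n (\<lambda>s. \<Sum>s'\<leftarrow>tree_insertions () s. \<phi> s') / (2 * real n - 1)"
proof -
  have sum: "(\<Sum>t\<in>PORTs (Suc n). \<phi> (shape t)) =
      (\<Sum>t\<in>PORTs n. \<Sum>s'\<leftarrow>tree_insertions () (shape t). \<phi> s')" for \<phi> :: "unit ptree \<Rightarrow> real"
    unfolding sum_PORTs_Suc[OF assms, of "\<lambda>t. \<phi> (shape t)"]
    by (simp add: o_def flip: map_shape_tree_insertions[of "Suc n"])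
  \<comment> \<open>The same identity for the constant function 1 counts the trees.\<close>
  have "real (card (PORTs (Suc n))) = (\<Sum>t\<in>PORTs n. 2 * real n - 1)"
  proof -
    have "real (card (PORTs (Suc n))) = (\<Sum>t\<in>PORTs n. real (2 * tree_size (shape t) - 1))"
      using sum[of "\<lambda>_. 1"] by (simp only: sum_list_triv length_tree_insertions) simp
    also have "\<dots> = (\<Sum>t\<in>PORTs n. 2 * real n - 1)"
      using assms by (intro sum.cong refl) (simp add: tree_size_shape tree_size_PORTs of_nat_diff)
    finally show ?thesis .
  qed
  then show ?thesis
    by (simp add: PORT_mean_def sum mult.commute)
qed

lemma PORTs_1: "PORTs 1 = {Node 1 []}"
proof (intro equalityI subsetI)
  fix t assume t: "t \<in> PORTs 1"
  obtain a us where t_eq: "t = Node a us" by (cases t)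
  have "mset (a # forest_labels us) = mset_set {1..1}"
    using t unfolding t_eq PORTs_iff by blast
  then have "a = 1" by simp
  moreover have "forest_size us = 0"
    using tree_size_PORTs[OF t] by (simp add: t_eq)
  then have "us = []"
    by (cases us rule: forest_size.cases) auto
  ultimately show "t \<in> {Node 1 []}"
    by (simp add: t_eq)
qed (auto simp: PORTs_def)

lemma PORT_mean_1: "PORT_mean 1 \<phi> = \<phi> (Node () [])"
  by (simp add: PORT_mean_def PORTs_1 del: One_nat_def)

section \<open>Fringe sums and pairs of incomparable fringe subtrees\<close>

fun fringe_sum :: "('a ptree \<Rightarrow> real) \<Rightarrow> 'a ptree list \<Rightarrow> real" where
  "fringe_sum f [] = 0"
| "fringe_sum f (Node a us # ts) = f (Node a us) + fringe_sum f us + fringe_sum f ts"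

text \<open>The sum of \<open>f u * g v\<close> over ordered pairs of fringe subtrees \<open>u\<close>, \<open>v\<close> neither of which contains
  the other.\<close>

fun pair_sum :: "('a ptree \<Rightarrow> real) \<Rightarrow> ('a ptree \<Rightarrow> real) \<Rightarrow> 'a ptree list \<Rightarrow> real" where
  "pair_sum f g [] = 0"
| "pair_sum f g (Node a us # ts) = pair_sum f g us + pair_sum f g ts
     + (f (Node a us) + fringe_sum f us) * fringe_sum g ts
     + fringe_sum f ts * (g (Node a us) + fringe_sum g us)"

text \<open>The generator of the growth chain, without division by the number of slots.\<close>

definition insertion_gain :: "(unit ptree \<Rightarrow> real) \<Rightarrow> unit ptree \<Rightarrow> real" where
  "insertion_gain f s =
     (\<Sum>s'\<leftarrow>tree_insertions () s. f s') - real (2 * tree_size s - 1) * f s"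

text \<open>The weight is the number of slots inside the tree: a leaf put into one of them is
  contained in the tree and forms no incomparable pair with it.\<close>

definition slot_weighted :: "(unit ptree \<Rightarrow> real) \<Rightarrow> unit ptree \<Rightarrow> real" where
  "slot_weighted f s = real (2 * tree_size s - 1) * f s"

lemma insertion_gain_Node:
  "insertion_gain f (Node () us) =
     (\<Sum>vs\<leftarrow>leaf_insertions () us. f (Node () vs)) - (2 * real (forest_size us) + 1) * f (Node () us)"
  by (simp add: insertion_gain_def o_def)

lemma slot_weighted_Node: "slot_weighted f (Node () us) = (2 * real (forest_size us) + 1) * f (Node () us)"
  by (simp add: slot_weighted_def)

text \<open>Each of the slots creates one new fringe subtree, a leaf, and alters exactly the fringe
  subtrees that contain the slot. Collecting the changes for each of these gives its insertion
  gain.\<close>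

lemma sum_list_leaf_insertions_fringe_sum:
  "(\<Sum>ts'\<leftarrow>leaf_insertions () ts. fringe_sum f ts') =
     (2 * real (forest_size ts) + 1) * (fringe_sum f ts + f (Node () []))
     + fringe_sum (insertion_gain f) ts"
proof (induction ts rule: forest_induct)
  case (Cons a us ts)
  show ?case
    using Cons.IH
    by (simp add: o_def sum_list_addf sum_list_triv length_leaf_insertions insertion_gain_Node
        algebra_simps)
qed simp

text \<open>A slot lies in at most one member of an incomparable pair, hence two separate gain terms
  and no mixed one. New pairs consist of the new leaf and a fringe subtree not containing the slot,
  hence all slots minus those inside.\<close>

lemma sum_list_leaf_insertions_pair_sum:
  "(\<Sum>ts'\<leftarrow>leaf_insertions () ts. pair_sum f g ts') =
     (2 * real (forest_size ts) + 1) * pair_sum f g ts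
     + pair_sum (insertion_gain f) g ts + pair_sum f (insertion_gain g) ts
     + f (Node () []) * ((2 * real (forest_size ts) + 1) * fringe_sum g ts
         - fringe_sum (slot_weighted g) ts)
     + g (Node () []) * ((2 * real (forest_size ts) + 1) * fringe_sum f ts
         - fringe_sum (slot_weighted f) ts)"
proof (induction ts rule: forest_induct)
  case (Cons a us ts)
  show ?case
    using Cons.IH
    by (simp add: o_def sum_list_addf sum_list_triv length_leaf_insertions insertion_gain_Node
        slot_weighted_Node sum_list_mult_const sum_list_const_mult sum_list_leaf_insertions_fringe_sum
        algebra_simps)
qed simp


lemma sum_list_tree_insertions_fringe_sum:
  "(\<Sum>s'\<leftarrow>tree_insertions () s. fringe_sum f [s']) =
     (2 * real (tree_size s) - 1) * (fringe_sum f [s] + f (Node () []))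
     + fringe_sum (insertion_gain f) [s]"
  by (cases s)
    (simp add: o_def sum_list_addf sum_list_leaf_insertions_fringe_sum insertion_gain_Node algebra_simps)

lemma sum_list_tree_insertions_pair_sum:
  "(\<Sum>s'\<leftarrow>tree_insertions () s. pair_sum f g [s']) =
     (2 * real (tree_size s) - 1) * pair_sum f g [s]
     + pair_sum (insertion_gain f) g [s] + pair_sum f (insertion_gain g) [s]
     + f (Node () []) * ((2 * real (tree_size s) - 1) * fringe_sum g [s]
         - fringe_sum (slot_weighted g) [s])
     + g (Node () []) * ((2 * real (tree_size s) - 1) * fringe_sum f [s]
         - fringe_sum (slot_weighted f) [s])"
  by (cases s)
    (simp add: o_def sum_list_leaf_insertions_pair_sum slot_weighted_Node algebra_simps)

lemma PORT_mean_insertion_gain: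
  assumes "n \<ge> 1"
  shows "PORT_mean n (insertion_gain f) = (2 * real n - 1) * (PORT_mean (Suc n) f - PORT_mean n f)"
proof -
  have "PORT_mean n (insertion_gain f) =
      PORT_mean n (\<lambda>s. (\<Sum>s'\<leftarrow>tree_insertions () s. f s') - (2 * real n - 1) * f s)"
    using assms by (intro PORT_mean_cong) (simp add: insertion_gain_def of_nat_diff)
  also have "\<dots> = PORT_mean n (\<lambda>s. \<Sum>s'\<leftarrow>tree_insertions () s. f s') - (2 * real n - 1) * PORT_mean n f"
    by (simp only: PORT_mean_diff PORT_mean_cmult)
  moreover have "2 * real n - 1 \<noteq> 0"
    using assms by simp
  ultimately show ?thesis
    by (simp add: PORT_mean_Suc[OF assms] right_diff_distrib)
qed

lemma PORT_mean_Suc_fringe_sum: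
  assumes "n \<ge> 1"
  shows "PORT_mean (Suc n) (\<lambda>s. fringe_sum f [s]) =
    PORT_mean n (\<lambda>s. fringe_sum f [s]) + f (Node () [])
    + PORT_mean n (\<lambda>s. fringe_sum (insertion_gain f) [s]) / (2 * real n - 1)"
proof -
  have "PORT_mean n (\<lambda>s. \<Sum>s'\<leftarrow>tree_insertions () s. fringe_sum f [s']) =
      PORT_mean n (\<lambda>s. (2 * real n - 1) * (fringe_sum f [s] + f (Node () []))
        + fringe_sum (insertion_gain f) [s])"
    by (intro PORT_mean_cong) (simp only: sum_list_tree_insertions_fringe_sum)
  also have "\<dots> = (2 * real n - 1) * (PORT_mean n (\<lambda>s. fringe_sum f [s]) + f (Node () []))
      + PORT_mean n (\<lambda>s. fringe_sum (insertion_gain f) [s])"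
    by (simp only: PORT_mean_add PORT_mean_cmult PORT_mean_const[OF assms])
  finally show ?thesis
    using assms by (simp add: PORT_mean_Suc[OF assms] field_simps)
qed

lemma PORT_mean_Suc_pair_sum:
  assumes "n \<ge> 1"
  shows "PORT_mean (Suc n) (\<lambda>s. pair_sum f g [s]) =
    PORT_mean n (\<lambda>s. pair_sum f g [s])
    + (PORT_mean n (\<lambda>s. pair_sum (insertion_gain f) g [s])
       + PORT_mean n (\<lambda>s. pair_sum f (insertion_gain g) [s])
       + f (Node () []) * ((2 * real n - 1) * PORT_mean n (\<lambda>s. fringe_sum g [s])
           - PORT_mean n (\<lambda>s. fringe_sum (slot_weighted g) [s]))
       + g (Node () []) * ((2 * real n - 1) * PORT_mean n (\<lambda>s. fringe_sum f [s])
           - PORT_mean n (\<lambda>s. fringe_sum (slot_weighted f) [s]))) / (2 * real n - 1)"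
proof -
  have "PORT_mean n (\<lambda>s. \<Sum>s'\<leftarrow>tree_insertions () s. pair_sum f g [s']) =
      PORT_mean n (\<lambda>s. (2 * real n - 1) * pair_sum f g [s]
     + pair_sum (insertion_gain f) g [s] + pair_sum f (insertion_gain g) [s]
     + f (Node () []) * ((2 * real n - 1) * fringe_sum g [s] - fringe_sum (slot_weighted g) [s])
     + g (Node () []) * ((2 * real n - 1) * fringe_sum f [s] - fringe_sum (slot_weighted f) [s]))"
    by (intro PORT_mean_cong) (simp only: sum_list_tree_insertions_pair_sum)
  also have "\<dots> = (2 * real n - 1) * PORT_mean n (\<lambda>s. pair_sum f g [s])
       + PORT_mean n (\<lambda>s. pair_sum (insertion_gain f) g [s])
       + PORT_mean n (\<lambda>s. pair_sum f (insertion_gain g) [s])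
       + f (Node () []) * ((2 * real n - 1) * PORT_mean n (\<lambda>s. fringe_sum g [s])
           - PORT_mean n (\<lambda>s. fringe_sum (slot_weighted g) [s]))
       + g (Node () []) * ((2 * real n - 1) * PORT_mean n (\<lambda>s. fringe_sum f [s])
           - PORT_mean n (\<lambda>s. fringe_sum (slot_weighted f) [s]))"
    by (simp only: PORT_mean_add PORT_mean_diff PORT_mean_cmult)
  finally show ?thesis
    using assms by (simp add: PORT_mean_Suc[OF assms] field_simps)
qed

lemma PORT_mean_fringe_sum_eq_0:
  assumes "n \<ge> 1" "\<And>k. k \<ge> 1 \<Longrightarrow> PORT_mean k f = 0"
  shows "PORT_mean n (\<lambda>s. fringe_sum f [s]) = 0"
  using assms
proof (induction n arbitrary: f rule: nat_induct_at_least)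
  case base
  then show ?case
    using base[of 1] by (simp add: PORT_mean_1 del: One_nat_def)
next
  case (Suc n)
  have "f (Node () []) = 0"
    using Suc.prems[of 1] by (simp add: PORT_mean_1 del: One_nat_def)
  moreover have "PORT_mean n (\<lambda>s. fringe_sum f [s]) = 0"
    using Suc.IH Suc.prems by blast
  moreover have "PORT_mean n (\<lambda>s. fringe_sum (insertion_gain f) [s]) = 0"
    using Suc.prems by (intro Suc.IH) (simp add: PORT_mean_insertion_gain)
  ultimately show ?case
    using Suc.hyps by (simp add: PORT_mean_Suc_fringe_sum)
qed

text \<open>The insertion step maps observables of mean zero at every size to observables of the same kind,
  so the means of fringe sums and pair sums depend on \<open>f\<close> only through its means at each size.
  This replaces the conditional independence of the fringe subtrees given their sizes.\<close>

lemma PORT_mean_pair_sum_eq_0: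
  assumes "n \<ge> 1" "\<And>k. k \<ge> 1 \<Longrightarrow> PORT_mean k f = 0"
  shows "PORT_mean n (\<lambda>s. pair_sum f g [s]) = 0"
  using assms
proof (induction n arbitrary: f g rule: nat_induct_at_least)
  case base
  then show ?case
    by (simp add: PORT_mean_1 del: One_nat_def)
next
  case (Suc n)
  have leaf: "f (Node () []) = 0"
    using Suc.prems[of 1] by (simp add: PORT_mean_1 del: One_nat_def)
  have "PORT_mean n (\<lambda>s. pair_sum f g [s]) = 0" "PORT_mean n (\<lambda>s. pair_sum f (insertion_gain g) [s]) = 0"
    using Suc.IH Suc.prems by blast+
  moreover have "PORT_mean n (\<lambda>s. pair_sum (insertion_gain f) g [s]) = 0"
    using Suc.prems by (intro Suc.IH) (simp add: PORT_mean_insertion_gain)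
  moreover have "PORT_mean n (\<lambda>s. fringe_sum f [s]) = 0"
    using PORT_mean_fringe_sum_eq_0 Suc.hyps Suc.prems by blast
  \<comment> \<open>At each fixed size \<open>slot_weighted\<close> multiplies by a constant, so it
    keeps all means zero.\<close>
  moreover have "PORT_mean n (\<lambda>s. fringe_sum (slot_weighted f) [s]) = 0"
  proof (rule PORT_mean_fringe_sum_eq_0)
    fix k :: nat assume "k \<ge> 1"
    have "PORT_mean k (slot_weighted f) = PORT_mean k (\<lambda>s. real (2 * k - 1) * f s)"
      by (intro PORT_mean_cong) (simp add: slot_weighted_def)
    then show "PORT_mean k (slot_weighted f) = 0"
      using Suc.prems \<open>k \<ge> 1\<close> by (simp only: PORT_mean_cmult)
  qed (use Suc.hyps in simp)
  ultimately show ?case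
    using Suc.hyps leaf by (simp add: PORT_mean_Suc_pair_sum)
qed

lemma fringe_sum_diff: "fringe_sum (\<lambda>s. f s - g s) ts = fringe_sum f ts - fringe_sum g ts"
  by (induction ts rule: forest_induct) auto

lemma fringe_sum_cmult: "fringe_sum (\<lambda>s. c * f s) ts = c * fringe_sum f ts"
  by (induction ts rule: forest_induct) (auto simp: algebra_simps)

lemma fringe_sum_sum: "fringe_sum (\<lambda>s. \<Sum>i\<in>I. f i s) ts = (\<Sum>i\<in>I. fringe_sum (f i) ts)"
  by (induction ts rule: forest_induct) (auto simp: sum.distrib)

lemma fringe_sum_mono:
  assumes "\<And>s. tree_size s \<le> forest_size ts \<Longrightarrow> f s \<le> g s"
  shows "fringe_sum f ts \<le> fringe_sum g ts"
  using assms
proof (induction ts rule: forest_induct)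
  case (Cons a us ts)
  have "f (Node a us) \<le> g (Node a us)"
    by (rule Cons.prems) simp
  moreover have "fringe_sum f us \<le> fringe_sum g us" "fringe_sum f ts \<le> fringe_sum g ts"
    by (auto intro!: Cons.IH Cons.prems)
  ultimately show ?case by simp
qed simp

lemma fringe_sum_cong:
  assumes "\<And>s. tree_size s \<le> forest_size ts \<Longrightarrow> f s = g s"
  shows "fringe_sum f ts = fringe_sum g ts"
  by (intro antisym fringe_sum_mono) (simp_all add: assms)

lemma fringe_sum_one: "fringe_sum (\<lambda>_. 1) ts = real (forest_size ts)"
  by (induction ts rule: forest_induct) auto

lemma fringe_sum_nonneg: "(\<And>s. f s \<ge> 0) \<Longrightarrow> fringe_sum f ts \<ge> 0"
  by (induction ts rule: forest_induct) auto

lemma pair_sum_diff_left: "pair_sum (\<lambda>s. f s - c * f' s) g ts = pair_sum f g ts - c * pair_sum f' g ts"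
  by (induction ts rule: forest_induct) (auto simp: fringe_sum_diff fringe_sum_cmult algebra_simps)

lemma pair_sum_nonneg: "(\<And>s. f s \<ge> 0) \<Longrightarrow> (\<And>s. g s \<ge> 0) \<Longrightarrow> pair_sum f g ts \<ge> 0"
  by (induction ts rule: forest_induct) (auto simp: fringe_sum_nonneg)

lemma pair_sum_le_mult:
  assumes "\<And>s. f s \<ge> 0" "\<And>s. g s \<ge> 0"
  shows "pair_sum f g ts \<le> fringe_sum f ts * fringe_sum g ts"
proof (induction ts rule: forest_induct)
  case (Cons a us ts)
  have "fringe_sum f us * fringe_sum g us \<le> (f (Node a us) + fringe_sum f us) * (g (Node a us) + fringe_sum g us)"
    using assms by (intro mult_mono) (auto simp: fringe_sum_nonneg)
  then show ?case
    using Cons.IH by (simp add: algebra_simps)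
qed simp

lemma PORT_mean_pair_sum_cong_left:
  assumes "n \<ge> 1" "\<And>k. k \<ge> 1 \<Longrightarrow> PORT_mean k f = c * PORT_mean k f'"
  shows "PORT_mean n (\<lambda>s. pair_sum f g [s]) = c * PORT_mean n (\<lambda>s. pair_sum f' g [s])"
proof -
  have "PORT_mean n (\<lambda>s. pair_sum (\<lambda>s. f s - c * f' s) g [s]) = 0"
    using assms by (intro PORT_mean_pair_sum_eq_0) (simp_all add: PORT_mean_diff PORT_mean_cmult)
  then show ?thesis
    by (simp only: pair_sum_diff_left PORT_mean_diff PORT_mean_cmult right_minus_eq)
qed

section \<open>Shape probabilities and coinciding pairs\<close>

definition shape_prob :: "unit ptree \<Rightarrow> real" where
  "shape_prob T = PORT_mean (tree_size T) (\<lambda>s. of_bool (s = T))"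

lemma PORT_mean_nonneg: "(\<And>s. \<phi> s \<ge> 0) \<Longrightarrow> PORT_mean n \<phi> \<ge> 0"
  by (simp add: PORT_mean_def sum_nonneg)

lemma shape_prob_nonneg: "shape_prob T \<ge> 0"
  unfolding shape_prob_def by (rule PORT_mean_nonneg) simp

lemma tree_size_ge_1: "tree_size t \<ge> 1"
  by (cases t) simp

text \<open>Agreement of the means at every size, including those where both sides vanish, is what
  allows the indicator of \<open>T\<close> to be exchanged for its probability times the indicator
  of its size.\<close>

lemma PORT_mean_shape_indicator:
  assumes "k \<ge> 1"
  shows "PORT_mean k (\<lambda>s. of_bool (s = T)) =
    shape_prob T * PORT_mean k (\<lambda>s. of_bool (tree_size s = tree_size T))"
proof (cases "k = tree_size T")
  case True
  have "PORT_mean k (\<lambda>s. of_bool (tree_size s = tree_size T)) = PORT_mean k (\<lambda>_. 1)"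
    using True by (intro PORT_mean_cong) simp
  then show ?thesis
    using assms True by (simp add: shape_prob_def PORT_mean_const)
next
  case False
  have "PORT_mean k (\<lambda>s. of_bool (tree_size s = tree_size T)) = PORT_mean k (\<lambda>_. 0)"
    using False by (intro PORT_mean_cong) simp
  moreover have "PORT_mean k (\<lambda>s. of_bool (s = T)) = PORT_mean k (\<lambda>_. 0)"
    using False by (intro PORT_mean_cong) auto
  ultimately show ?thesis
    using assms by (simp add: PORT_mean_const)
qed

text \<open>Only the first member of the pair is averaged out, and there are at most
  \<open>n\<close> candidates for it. The second keeps its indicator, so that a later sum over
  shapes costs one more factor \<open>n\<close> and not the number of shapes.\<close>

lemma PORT_mean_pair_sum_shape_le:
  assumes "n \<ge> 1"
  shows "PORT_mean n (\<lambda>s. pair_sum (\<lambda>u. of_bool (u = T)) (\<lambda>u. of_bool (u = T)) [s]) \<le>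
    shape_prob T * (real n * PORT_mean n (\<lambda>s. fringe_sum (\<lambda>u. of_bool (u = T)) [s]))"
proof -
  let ?I = "\<lambda>u. of_bool (u = T) :: real"
    and ?J = "\<lambda>u :: unit ptree. of_bool (tree_size u = tree_size T) :: real"
  have "PORT_mean n (\<lambda>s. pair_sum ?I ?I [s]) = shape_prob T * PORT_mean n (\<lambda>s. pair_sum ?J ?I [s])"
    by (intro PORT_mean_pair_sum_cong_left assms PORT_mean_shape_indicator)
  also have "PORT_mean n (\<lambda>s. pair_sum ?J ?I [s]) \<le> PORT_mean n (\<lambda>s. real n * fringe_sum ?I [s])"
  proof (rule PORT_mean_mono)
    fix s :: "unit ptree" assume s: "tree_size s = n"
    have "pair_sum ?J ?I [s] \<le> fringe_sum ?J [s] * fringe_sum ?I [s]"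
      by (rule pair_sum_le_mult) simp_all
    also have "fringe_sum ?J [s] \<le> fringe_sum (\<lambda>_. 1) [s]"
      by (rule fringe_sum_mono) simp
    also have "\<dots> = real n"
      by (simp only: fringe_sum_one s)
    finally show "pair_sum ?J ?I [s] \<le> real n * fringe_sum ?I [s]"
      by (simp add: mult_right_mono fringe_sum_nonneg)
  qed
  also have "\<dots> = real n * PORT_mean n (\<lambda>s. fringe_sum ?I [s])"
    by (rule PORT_mean_cmult)
  finally show ?thesis
    by (simp add: mult_left_mono shape_prob_nonneg)
qed

text \<open>A tower property: given its size, a fringe subtree behaves on average like a random tree
  of that size.\<close>

lemma PORT_mean_fringe_sum_conditional:
  assumes "n \<ge> 1"
  shows "PORT_mean n (\<lambda>s. fringe_sum f [s]) =
    PORT_mean n (\<lambda>s. fringe_sum (\<lambda>u. PORT_mean (tree_size u) f) [s])"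
proof -
  have "PORT_mean n (\<lambda>s. fringe_sum (\<lambda>u. f u - PORT_mean (tree_size u) f) [s]) = 0"
  proof (rule PORT_mean_fringe_sum_eq_0[OF assms])
    fix k :: nat assume k: "k \<ge> 1"
    have "PORT_mean k (\<lambda>u. f u - PORT_mean (tree_size u) f) = PORT_mean k (\<lambda>u. f u - PORT_mean k f)"
      by (intro PORT_mean_cong) simp
    then show "PORT_mean k (\<lambda>u. f u - PORT_mean (tree_size u) f) = 0"
      using k by (simp add: PORT_mean_diff PORT_mean_const)
  qed
  then show ?thesis
    by (simp only: fringe_sum_diff PORT_mean_diff right_minus_eq)
qed

section \<open>The number of large fringe subtrees\<close>

definition fringe_count :: "nat \<Rightarrow> unit ptree \<Rightarrow> real" where
  "fringe_count k s = fringe_sum (\<lambda>u. of_bool (k \<le> tree_size u)) [s]"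

lemma tree_size_tree_insertions: "s' \<in> set (tree_insertions x s) \<Longrightarrow> tree_size s' = Suc (tree_size s)"
  by (cases s) (auto simp: forest_size_leaf_insertions)

lemma insertion_gain_size:
  "insertion_gain (\<lambda>u. g (tree_size u)) s =
     (2 * real (tree_size s) - 1) * (g (Suc (tree_size s)) - g (tree_size s))"
proof -
  have "(\<Sum>s'\<leftarrow>tree_insertions () s. g (tree_size s')) = (\<Sum>s'\<leftarrow>tree_insertions () s. g (Suc (tree_size s)))"
    by (intro arg_cong[where f = sum_list] map_cong refl) (simp only: tree_size_tree_insertions)
  then show ?thesis
    using tree_size_ge_1[of s]
    by (simp add: insertion_gain_def sum_list_triv length_tree_insertions of_nat_diff right_diff_distrib)
qed

text \<open>Only trees of size exactly \<open>k\<close> cross the threshold, and each of their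
  \<open>2 * k - 1\<close> slots makes them cross. Writing "size exactly \<open>k\<close>" as a
  difference of thresholds closes the recursion on the counts.\<close>

lemma insertion_gain_size_at_least:
  assumes "k \<ge> 1"
  shows "insertion_gain (\<lambda>u. of_bool (Suc k \<le> tree_size u)) =
    (\<lambda>s. (2 * real k - 1) * (of_bool (k \<le> tree_size s) - of_bool (Suc k \<le> tree_size s)))"
proof
  fix s :: "unit ptree"
  show "insertion_gain (\<lambda>u. of_bool (Suc k \<le> tree_size u)) s =
    (2 * real k - 1) * (of_bool (k \<le> tree_size s) - of_bool (Suc k \<le> tree_size s))"
    unfolding insertion_gain_size[of "\<lambda>m. of_bool (Suc k \<le> m)"] by auto
qed

lemma fringe_sum_insertion_gain_size_at_least:
  assumes "k \<ge> 1"
  shows "fringe_sum (insertion_gain (\<lambda>u. of_bool (Suc k \<le> tree_size u))) [s] =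
    (2 * real k - 1) * (fringe_count k s - fringe_count (Suc k) s)"
  unfolding insertion_gain_size_at_least[OF assms] fringe_sum_cmult fringe_sum_diff fringe_count_def ..

lemma fringe_sum_zero: "fringe_sum (\<lambda>_. 0) ts = 0"
  by (induction ts rule: forest_induct) auto

lemma fringe_sum_size_at_least_eq_0:
  assumes "forest_size ts < k"
  shows "fringe_sum (\<lambda>u. of_bool (k \<le> tree_size u)) ts = 0"
proof -
  have "fringe_sum (\<lambda>u. of_bool (k \<le> tree_size u)) ts = fringe_sum (\<lambda>_. 0) ts"
    using assms by (intro fringe_sum_cong) auto
  then show ?thesis
    by (simp only: fringe_sum_zero)
qed

lemma fringe_count_eq_0: "tree_size s < k \<Longrightarrow> fringe_count k s = 0"
  unfolding fringe_count_def by (rule fringe_sum_size_at_least_eq_0)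

lemma fringe_count_1: "fringe_count 1 s = real (tree_size s)"
proof -
  have "fringe_count 1 s = fringe_sum (\<lambda>_. 1) [s]"
    unfolding fringe_count_def by (intro fringe_sum_cong) (simp only: tree_size_ge_1 of_bool_eq)
  then show ?thesis
    by (simp only: fringe_sum_one)
qed

lemma PORT_mean_Suc_fringe_count:
  assumes "n \<ge> 1" "k \<ge> 1"
  shows "PORT_mean (Suc n) (fringe_count (Suc k)) =
    PORT_mean n (fringe_count (Suc k)) + (2 * real k - 1) / (2 * real n - 1)
      * (PORT_mean n (fringe_count k) - PORT_mean n (fringe_count (Suc k)))"
proof -
  have "PORT_mean n (\<lambda>s. fringe_sum (insertion_gain (\<lambda>u. of_bool (Suc k \<le> tree_size u))) [s]) =
      (2 * real k - 1) * (PORT_mean n (fringe_count k) - PORT_mean n (fringe_count (Suc k)))"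
    by (simp only: fringe_sum_insertion_gain_size_at_least[OF assms(2)] PORT_mean_cmult PORT_mean_diff)
  then show ?thesis
    using PORT_mean_Suc_fringe_sum[OF assms(1), of "\<lambda>u. of_bool (Suc k \<le> tree_size u)"] assms(2)
    by (simp add: fringe_count_def[abs_def])
qed

lemma PORT_mean_fringe_count:
  assumes "1 \<le> k" "k \<le> n"
  shows "PORT_mean n (fringe_count k) = 1 / 2 + (2 * real n - 1) / (2 * (2 * real k - 1))"
proof -
  have "n \<ge> 1" using assms by simp
  then show ?thesis
    using assms
  proof (induction n arbitrary: k rule: nat_induct_at_least)
    case base
    then have "k = 1" by simp
    then show ?case
      by (simp add: PORT_mean_1 fringe_count_1 del: One_nat_def)
  next
    case (Suc n)
    show ?case
    proof (cases "k = 1")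
      case True
      have "PORT_mean (Suc n) (fringe_count k) = PORT_mean (Suc n) (\<lambda>_. real (Suc n))"
        unfolding True by (intro PORT_mean_cong) (simp only: fringe_count_1)
      then show ?thesis
        by (simp add: PORT_mean_const True field_simps)
    next
      case False
      then obtain j where j: "k = Suc j" "j \<ge> 1"
        using Suc.prems by (cases k) auto
      have IH: "PORT_mean n (fringe_count j) = 1 / 2 + (2 * real n - 1) / (2 * (2 * real j - 1))"
        using Suc j by simp
      \<comment> \<open>The closed form holds only up to threshold \<open>n\<close>; at
        \<open>j = n\<close> the count is 0 because no fringe subtree exceeds the whole
        tree.\<close>
      have IH': "PORT_mean n (fringe_count (Suc j)) =
          (if j = n then 0 else 1 / 2 + (2 * real n - 1) / (2 * (2 * real j + 1)))"
      proof (cases "j = n")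
        case True
        have "PORT_mean n (fringe_count (Suc j)) = PORT_mean n (\<lambda>_. 0)"
          using True by (intro PORT_mean_cong) (simp add: fringe_count_eq_0)
        then show ?thesis
          using True Suc.hyps by (simp add: PORT_mean_const)
      next
        case False
        then show ?thesis
          using Suc j by (simp add: algebra_simps)
      qed
      define x y where "x = real n" and "y = real j"
      have "2 * x - 1 > 0" "2 * y - 1 > 0"
        using Suc.hyps j by (auto simp: x_def y_def)
      then show ?thesis
        using j Suc.hyps unfolding j(1) PORT_mean_Suc_fringe_count[OF Suc.hyps j(2)] IH IH'
        by (auto simp: divide_simps simp flip: x_def y_def) (auto simp: x_def y_def algebra_simps)
    qed
  qed
qed

text \<open>The fringe subtrees that grow lie on one path towards the root and have pairwise
  different sizes, so at most one of them passes from \<open>k - 1\<close> to \<open>k\<close>. The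
  new leaf is not counted because \<open>k >= 2\<close>.\<close>

lemma fringe_sum_size_leaf_insertions:
  assumes "vs \<in> set (leaf_insertions () ts)" "k \<ge> 2"
  shows "fringe_sum (\<lambda>u. of_bool (k \<le> tree_size u)) vs - fringe_sum (\<lambda>u. of_bool (k \<le> tree_size u)) ts \<in> {0, 1}"
  using assms
proof (induction ts arbitrary: vs rule: forest_induct)
  case (Cons a us ts)
  let ?f = "\<lambda>u :: unit ptree. of_bool (k \<le> tree_size u) :: real"
  consider "vs = Node () [] # Node a us # ts"
    | us' where "vs = Node a us' # ts" "us' \<in> set (leaf_insertions () us)"
    | ts' where "vs = Node a us # ts'" "ts' \<in> set (leaf_insertions () ts)"
    using Cons.prems(1) by auto
  then show ?case
  proof cases
    case 2
    have size: "forest_size us' = Suc (forest_size us)"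
      using 2 by (simp add: forest_size_leaf_insertions)
    have IH: "fringe_sum ?f us' - fringe_sum ?f us \<in> {0, 1}"
      using Cons.IH(1) 2 Cons.prems by blast
    show ?thesis
    proof (cases "k = Suc (Suc (forest_size us))")
      case True
      then have "fringe_sum ?f us' = 0" "fringe_sum ?f us = 0"
        using size by (simp_all only: fringe_sum_size_at_least_eq_0 lessI less_SucI)
      then show ?thesis
        using True size 2 by simp
    next
      case False
      then have "?f (Node a us') = ?f (Node a us)"
        using size by auto
      then show ?thesis
        using IH 2 by (simp del: forest_size.simps)
    qed
  next
    case 3
    have "fringe_sum ?f ts' - fringe_sum ?f ts \<in> {0, 1}"
      using Cons.IH(2) 3 Cons.prems by blast
    then show ?thesis
      using 3 by (simp del: forest_size.simps)
  qed (use Cons.prems in simp)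
qed simp

lemma fringe_count_tree_insertions:
  assumes "s' \<in> set (tree_insertions () s)" "k \<ge> 2"
  shows "fringe_count k s' - fringe_count k s \<in> {0, 1}"
proof -
  obtain a us where s: "s = Node a us" by (cases s)
  have "[s'] \<in> set (leaf_insertions () [s])"
    using assms(1) s by auto
  then show ?thesis
    unfolding fringe_count_def by (rule fringe_sum_size_leaf_insertions) (use assms in simp)
qed

lemma sum_list_tree_insertions_fringe_count:
  assumes "k \<ge> 1"
  shows "(\<Sum>s'\<leftarrow>tree_insertions () s. fringe_count (Suc k) s' - fringe_count (Suc k) s) =
    (2 * real k - 1) * (fringe_count k s - fringe_count (Suc k) s)"
proof -
  have "(\<Sum>s'\<leftarrow>tree_insertions () s. fringe_count (Suc k) s') =
      (2 * real (tree_size s) - 1) * fringe_count (Suc k) s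
      + (2 * real k - 1) * (fringe_count k s - fringe_count (Suc k) s)"
    using assms unfolding fringe_sum_insertion_gain_size_at_least[OF assms, symmetric]
    by (simp only: fringe_count_def sum_list_tree_insertions_fringe_sum) simp
  then show ?thesis
    using tree_size_ge_1[of s]
    by (simp add: sum_list_subtractf sum_list_triv length_tree_insertions of_nat_diff)
qed

section \<open>Variance of the counts\<close>

definition PORT_var :: "nat \<Rightarrow> (unit ptree \<Rightarrow> real) \<Rightarrow> real" where
  "PORT_var n f = PORT_mean n (\<lambda>s. (f s - PORT_mean n f)\<^sup>2)"

lemma convex_comb_square_le:
  fixes a b l :: real
  assumes "0 \<le> l" "l \<le> 1"
  shows "((1 - l) * a + l * b)\<^sup>2 \<le> (1 - l) * a\<^sup>2 + l * b\<^sup>2"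
proof -
  have "(1 - l) * a\<^sup>2 + l * b\<^sup>2 - ((1 - l) * a + l * b)\<^sup>2 = l * (1 - l) * (a - b)\<^sup>2"
    by (simp add: power2_eq_square algebra_simps)
  moreover have "l * (1 - l) * (a - b)\<^sup>2 \<ge> 0"
    using assms by simp
  ultimately show ?thesis by linarith
qed

text \<open>One insertion changes the count by a Bernoulli variable, whose variance is at most \<open>1/4\<close>,
  and the conditional mean is a convex combination of two consecutive counts.\<close>

lemma PORT_var_fringe_count_Suc:
  assumes "n \<ge> 1" "k \<ge> 1" "k \<le> n"
  defines "l \<equiv> (2 * real k - 1) / (2 * real n - 1)"
  shows "PORT_var (Suc n) (fringe_count (Suc k)) \<le>
    (1 - l) * PORT_var n (fringe_count (Suc k)) + l * PORT_var n (fringe_count k) + 1 / 4"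
proof -
  have pos: "2 * real n - 1 > 0"
    using assms by simp
  have l: "0 \<le> l" "l \<le> 1"
    using assms by (auto simp: l_def)
  define c where "c = PORT_mean (Suc n) (fringe_count (Suc k))"
  define m m' where "m = PORT_mean n (fringe_count k)" and "m' = PORT_mean n (fringe_count (Suc k))"
  have c: "c = (1 - l) * m' + l * m"
    unfolding c_def PORT_mean_Suc_fringe_count[OF assms(1,2)] l_def[symmetric] m_def m'_def
    by (simp add: algebra_simps)
  have step: "(\<Sum>s'\<leftarrow>tree_insertions () s. (fringe_count (Suc k) s' - c)\<^sup>2) \<le>
      (2 * real n - 1) * ((1 - l) * (fringe_count (Suc k) s - m')\<^sup>2 + l * (fringe_count k s - m)\<^sup>2 + 1 / 4)"
    if "tree_size s = n" for s
  proof -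
    define y x where "y = fringe_count (Suc k) s" and "x = fringe_count k s - y"
    have "(\<Sum>s'\<leftarrow>tree_insertions () s. (fringe_count (Suc k) s' - c)\<^sup>2) =
        (\<Sum>s'\<leftarrow>tree_insertions () s. (y - c)\<^sup>2 + (2 * (y - c) + 1) * (fringe_count (Suc k) s' - y))"
    proof (intro arg_cong[where f = sum_list] map_cong refl)
      fix s' assume "s' \<in> set (tree_insertions () s)"
      then have "fringe_count (Suc k) s' - y \<in> {0, 1}"
        unfolding y_def using assms(2) by (intro fringe_count_tree_insertions) auto
      then show "(fringe_count (Suc k) s' - c)\<^sup>2 = (y - c)\<^sup>2 + (2 * (y - c) + 1) * (fringe_count (Suc k) s' - y)"
        by (auto simp: algebra_simps power2_eq_square)
    qed
    also have "\<dots> = (2 * real n - 1) * (y - c)\<^sup>2 + (2 * (y - c) + 1) * ((2 * real k - 1) * x)"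
      using that assms(1) sum_list_tree_insertions_fringe_count[OF assms(2), of s]
      by (simp add: sum_list_addf sum_list_triv length_tree_insertions of_nat_diff sum_list_const_mult
          flip: y_def x_def)
    also have "(2 * real k - 1) * x = (2 * real n - 1) * (l * x)"
      using pos by (simp add: l_def)
    \<comment> \<open>Given the tree, the count increases with probability \<open>p = l * x\<close>;
      its variance is \<open>p * (1 - p) = 1 / 4 - (p - 1 / 2)^2\<close>.\<close>
    also have "(2 * real n - 1) * (y - c)\<^sup>2 + (2 * (y - c) + 1) * ((2 * real n - 1) * (l * x)) =
        (2 * real n - 1) * ((y - c + l * x)\<^sup>2 + 1 / 4 - (l * x - 1 / 2)\<^sup>2)"
      by (simp add: power2_eq_square algebra_simps)
    also have "\<dots> \<le> (2 * real n - 1) * ((y - c + l * x)\<^sup>2 + 1 / 4)"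
      using pos by (intro mult_left_mono) auto
    also have "y - c + l * x = (1 - l) * (fringe_count (Suc k) s - m') + l * (fringe_count k s - m)"
      by (simp add: c x_def y_def algebra_simps)
    also have "(2 * real n - 1) * (((1 - l) * (fringe_count (Suc k) s - m') + l * (fringe_count k s - m))\<^sup>2 + 1 / 4)
        \<le> (2 * real n - 1) * ((1 - l) * (fringe_count (Suc k) s - m')\<^sup>2 + l * (fringe_count k s - m)\<^sup>2 + 1 / 4)"
      using pos convex_comb_square_le[OF l] by (intro mult_left_mono add_right_mono) auto
    finally show ?thesis .
  qed
  have "PORT_var (Suc n) (fringe_count (Suc k)) =
      PORT_mean n (\<lambda>s. \<Sum>s'\<leftarrow>tree_insertions () s. (fringe_count (Suc k) s' - c)\<^sup>2) / (2 * real n - 1)"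
    unfolding PORT_var_def PORT_mean_Suc[OF assms(1), symmetric] c_def ..
  also have "\<dots> \<le> PORT_mean n (\<lambda>s. (2 * real n - 1) * ((1 - l) * (fringe_count (Suc k) s - m')\<^sup>2
      + l * (fringe_count k s - m)\<^sup>2 + 1 / 4)) / (2 * real n - 1)"
    using pos step by (intro divide_right_mono PORT_mean_mono) auto
  also have "\<dots> = (1 - l) * PORT_var n (fringe_count (Suc k)) + l * PORT_var n (fringe_count k) + 1 / 4"
    using pos by (simp add: PORT_mean_cmult PORT_mean_add PORT_mean_const[OF assms(1)] PORT_var_def m_def m'_def)
  finally show ?thesis .
qed

text \<open>The weights \<open>1 - l\<close> and \<open>l\<close> add up to 1, so a bound common to
  all thresholds grows by only \<open>1 / 4\<close> per step. For \<open>k = 1\<close> and for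
  \<open>k\<close> above the size the count is deterministic.\<close>

lemma PORT_var_fringe_count_le:
  assumes "n \<ge> 1" "k \<ge> 1"
  shows "PORT_var n (fringe_count k) \<le> real n / 4"
proof -
  have const: "PORT_var n f = 0" if "n \<ge> 1" "\<And>s. tree_size s = n \<Longrightarrow> f s = c" for n f c
  proof -
    have "PORT_mean n f = PORT_mean n (\<lambda>_. c)"
      using that by (intro PORT_mean_cong) auto
    then have "PORT_mean n f = c"
      using that by (simp add: PORT_mean_const)
    then have "PORT_var n f = PORT_mean n (\<lambda>_. 0)"
      unfolding PORT_var_def using that(2) by (intro PORT_mean_cong) auto
    then show ?thesis
      using that by (simp add: PORT_mean_const)
  qed
  show ?thesis
    using assms
  proof (induction n arbitrary: k rule: nat_induct_at_least)
    case base
    have "tree_size s = 1 \<Longrightarrow> s = Node () []" for s :: "unit ptree"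
      by (cases s; cases "children s" rule: forest_size.cases) auto
    then have "PORT_var 1 (fringe_count k) = 0"
      by (intro const[where c = "fringe_count k (Node () [])"]) auto
    then show ?case by simp
  next
    case (Suc n)
    consider "k = 1" | "k > Suc n" | j where "k = Suc j" "1 \<le> j" "j \<le> n"
      using Suc.prems by (cases k) force+
    then show ?case
    proof cases
      case 1
      then have "PORT_var (Suc n) (fringe_count k) = 0"
        by (intro const[where c = "real (Suc n)"]) (simp, simp only: fringe_count_1)
      then show ?thesis by simp
    next
      case 2
      then have "PORT_var (Suc n) (fringe_count k) = 0"
        by (intro const[where c = 0]) (simp_all add: fringe_count_eq_0)
      then show ?thesis by simp
    next
      case 3
      define l where "l = (2 * real j - 1) / (2 * real n - 1)"
      have l: "0 \<le> l" "l \<le> 1"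
        using 3 by (auto simp: l_def)
      have "PORT_var (Suc n) (fringe_count k) \<le>
          (1 - l) * PORT_var n (fringe_count k) + l * PORT_var n (fringe_count j) + 1 / 4"
        using PORT_var_fringe_count_Suc[OF Suc.hyps 3(2,3)] by (simp only: 3(1) l_def)
      also have "\<dots> \<le> (1 - l) * (real n / 4) + l * (real n / 4) + 1 / 4"
        using l 3 Suc.prems by (intro add_right_mono add_mono mult_left_mono Suc.IH) auto
      also have "\<dots> = real (Suc n) / 4"
        by (simp add: field_simps)
      finally show ?thesis .
    qed
  qed
qed

section \<open>The probability of a shape\<close>

text \<open>Adjoint to \<^const>\<open>leaf_insertions\<close>; gives the hook length formula without counting labellings.\<close>

fun leaf_deletions :: "'a ptree list \<Rightarrow> 'a ptree list list" where
  "leaf_deletions [] = []"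
| "leaf_deletions (Node a us # ts) =
     (if us = [] then [ts] else [])
     @ map (\<lambda>vs. Node a vs # ts) (leaf_deletions us)
     @ map (\<lambda>vs. Node a us # vs) (leaf_deletions ts)"

lemma count_list_map_Node_Cons:
  "count_list (map (\<lambda>vs. Node a vs # ts) xs) (Node b us # ts') =
     (if a = b \<and> ts = ts' then count_list xs us else 0)"
  "count_list (map (\<lambda>vs. Node a ws # vs) xs) (Node b us # ts') =
     (if a = b \<and> ws = us then count_list xs ts' else 0)"
  "count_list (map (\<lambda>vs. Node a vs # ts) xs) [] = 0"
  "count_list (map (\<lambda>vs. Node a ws # vs) xs) [] = 0"
  by (induction xs) auto

lemma count_list_leaf_insertions:
  "count_list (leaf_insertions () ts) us = count_list (leaf_deletions us) ts"
proof (induction ts arbitrary: us rule: forest_induct)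
  case Nil
  show ?case
    by (cases us rule: forest_size.cases) (auto simp: count_list_map_Node_Cons)
next
  case (Cons a ws ts)
  show ?case
    by (cases us rule: forest_size.cases) (auto simp: count_list_map_Node_Cons Cons.IH)
qed

lemma forest_size_leaf_deletions:
  "vs \<in> set (leaf_deletions ts) \<Longrightarrow> Suc (forest_size vs) = forest_size ts"
  by (induction ts arbitrary: vs rule: forest_induct) (auto split: if_splits)

text \<open>By the hook length formula, \<open>m!\<close> times this is the number of increasing
  labellings of a forest with \<open>m\<close> vertices.\<close>

fun hook_weight :: "'a ptree list \<Rightarrow> real" where
  "hook_weight [] = 1"
| "hook_weight (Node a us # ts) = hook_weight us * hook_weight ts / real (Suc (forest_size us))"

text \<open>Up to factorials, the recursion for increasing labellings: the largest label sits on a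
  leaf, and deleting that leaf leaves an increasing labelling.\<close>

lemma sum_list_hook_weight_leaf_deletions:
  "(\<Sum>vs\<leftarrow>leaf_deletions ts. hook_weight vs) = real (forest_size ts) * hook_weight ts"
proof (induction ts rule: forest_induct)
  case (Cons a us ts)
  have "(\<Sum>vs\<leftarrow>leaf_deletions us. hook_weight (Node a vs # ts)) =
      (\<Sum>vs\<leftarrow>leaf_deletions us. hook_weight vs * (hook_weight ts / real (forest_size us)))"
    by (intro arg_cong[where f = sum_list] map_cong refl)
      (simp add: forest_size_leaf_deletions del: of_nat_Suc)
  also have "\<dots> = real (forest_size us) * hook_weight us * (hook_weight ts / real (forest_size us))"
    by (simp only: sum_list_mult_const Cons.IH)
  \<comment> \<open>For \<open>us = []\<close> nothing can be deleted below \<open>a\<close>; the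
    deletion of \<open>a\<close> itself then supplies the same value
    \<open>hook_weight us * hook_weight ts\<close>.\<close>
  finally have us: "(\<Sum>vs\<leftarrow>leaf_deletions us. hook_weight (Node a vs # ts)) =
      (if us = [] then 0 else hook_weight us * hook_weight ts)"
    by (cases us rule: forest_size.cases) auto
  have "(\<Sum>vs\<leftarrow>leaf_deletions ts. hook_weight (Node a us # vs)) =
      hook_weight us / real (Suc (forest_size us)) * (\<Sum>vs\<leftarrow>leaf_deletions ts. hook_weight vs)"
    by (simp add: sum_list_const_mult[symmetric] del: of_nat_Suc)
  then have ts: "(\<Sum>vs\<leftarrow>leaf_deletions ts. hook_weight (Node a us # vs)) =
      hook_weight us / real (Suc (forest_size us)) * (real (forest_size ts) * hook_weight ts)"
    by (simp only: Cons.IH)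
  define m where "m = real (Suc (forest_size us))"
  have "m > 0"
    by (simp add: m_def)
  have "(\<Sum>vs\<leftarrow>leaf_deletions (Node a us # ts). hook_weight vs) =
      hook_weight us * hook_weight ts + hook_weight us / m * (real (forest_size ts) * hook_weight ts)"
    using us ts by (auto simp: o_def m_def simp del: hook_weight.simps(2))
  also have "\<dots> = (m + real (forest_size ts)) * (hook_weight us * hook_weight ts / m)"
    using \<open>m > 0\<close> by (simp add: field_simps)
  also have "\<dots> = real (forest_size (Node a us # ts)) * hook_weight (Node a us # ts)"
    by (simp add: m_def)
  finally show ?case .
qed simp

lemma hook_weight_nonneg: "hook_weight ts \<ge> 0"
  by (induction ts rule: forest_induct) auto

lemma PORT_mean_sum_list:
  "n \<ge> 1 \<Longrightarrow> PORT_mean n (\<lambda>s. \<Sum>x\<leftarrow>xs. f x s) = (\<Sum>x\<leftarrow>xs. PORT_mean n (f x))"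
  by (induction xs) (simp_all add: PORT_mean_const PORT_mean_add)

lemma sum_list_of_bool_eq: "(\<Sum>x\<leftarrow>xs. of_bool (x = y)) = real (count_list xs y)"
  by (induction xs) auto

lemma PORT_mean_Suc_shape:
  assumes "n \<ge> 1"
  shows "PORT_mean (Suc n) (\<lambda>s. of_bool (s = Node () us)) =
    (\<Sum>vs\<leftarrow>leaf_deletions us. PORT_mean n (\<lambda>s. of_bool (s = Node () vs))) / (2 * real n - 1)"
proof -
  have "(\<Sum>s'\<leftarrow>tree_insertions () s. of_bool (s' = Node () us)) =
      (\<Sum>vs\<leftarrow>leaf_deletions us. of_bool (s = Node () vs) :: real)" for s
  proof -
    obtain ws where s: "s = Node () ws" by (cases s) auto
    have "(\<Sum>s'\<leftarrow>tree_insertions () s. of_bool (s' = Node () us)) = real (count_list (leaf_insertions () ws) us)"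
      by (simp add: s o_def sum_list_of_bool_eq)
    also have "\<dots> = real (count_list (leaf_deletions us) ws)"
      by (simp only: count_list_leaf_insertions)
    also have "\<dots> = (\<Sum>vs\<leftarrow>leaf_deletions us. of_bool (s = Node () vs))"
      unfolding sum_list_of_bool_eq[symmetric] by (simp add: s eq_commute)
    finally show ?thesis .
  qed
  then show ?thesis
    by (simp only: PORT_mean_Suc[OF assms] PORT_mean_sum_list[OF assms])
qed

text \<open>The exact factor is \<open>n! / (1 * 3 * ... * (2 * n - 3))\<close>; only its rate
  \<open>2 ^ (- n)\<close> matters. The polynomial \<open>2 * n^2\<close> is exact at
  \<open>n = 1\<close>, and the induction step reduces to
  \<open>2 * n^2 <= (n + 1) * (2 * n - 1)\<close>.\<close>

lemma PORT_mean_shape_le: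
  assumes "n \<ge> 1" "tree_size T = n"
  shows "PORT_mean n (\<lambda>s. of_bool (s = T)) \<le> 2 * (real n)\<^sup>2 / 2 ^ n * hook_weight [T]"
  using assms
proof (induction n arbitrary: T rule: nat_induct_at_least)
  case base
  then have "T = Node () []"
    by (cases T; cases "children T" rule: forest_size.cases) auto
  then show ?case
    by (simp add: PORT_mean_1 del: One_nat_def)
next
  case (Suc n)
  obtain us where T: "T = Node () us" by (cases T) auto
  have size: "forest_size us = n"
    using Suc.prems T by simp
  have n: "real n \<ge> 1" using Suc.hyps by simp
  have "PORT_mean (Suc n) (\<lambda>s. of_bool (s = T)) =
      (\<Sum>vs\<leftarrow>leaf_deletions us. PORT_mean n (\<lambda>s. of_bool (s = Node () vs))) / (2 * real n - 1)"
    unfolding T by (rule PORT_mean_Suc_shape[OF Suc.hyps])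
  also have "\<dots> \<le> (\<Sum>vs\<leftarrow>leaf_deletions us. 2 * real n / 2 ^ n * hook_weight vs) / (2 * real n - 1)"
  proof (intro divide_right_mono sum_list_mono)
    fix vs assume "vs \<in> set (leaf_deletions us)"
    then have vs: "Suc (forest_size vs) = n"
      using forest_size_leaf_deletions size by blast
    then have "PORT_mean n (\<lambda>s. of_bool (s = Node () vs)) \<le> 2 * (real n)\<^sup>2 / 2 ^ n * hook_weight [Node () vs]"
      by (intro Suc.IH) simp
    also have "hook_weight [Node () vs] = hook_weight vs / real n"
      using vs by simp
    also have "2 * (real n)\<^sup>2 / 2 ^ n * (hook_weight vs / real n) = 2 * real n / 2 ^ n * hook_weight vs"
      using n by (simp add: power2_eq_square)
    finally show "PORT_mean n (\<lambda>s. of_bool (s = Node () vs)) \<le> 2 * real n / 2 ^ n * hook_weight vs" .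
  qed (use n in simp)
  also have "\<dots> = 2 * real n / 2 ^ n * (real n * hook_weight us) / (2 * real n - 1)"
    by (simp only: sum_list_const_mult sum_list_hook_weight_leaf_deletions size)
  also have "hook_weight us = (real n + 1) * hook_weight [T]"
    by (simp add: T size add.commute)
  also have "2 * real n / 2 ^ n * (real n * ((real n + 1) * hook_weight [T])) / (2 * real n - 1) =
      (2 * (real n)\<^sup>2 * (real n + 1) / (2 * real n - 1)) / 2 ^ n * hook_weight [T]"
    by (simp add: power2_eq_square mult_ac)
  also have "\<dots> \<le> (real n + 1)\<^sup>2 / 2 ^ n * hook_weight [T]"
  proof (intro mult_right_mono divide_right_mono hook_weight_nonneg)
    have "2 * (real n)\<^sup>2 * (real n + 1) \<le> (real n + 1) * (2 * real n - 1) * (real n + 1)"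
      using n by (intro mult_right_mono) (auto simp: power2_eq_square algebra_simps)
    then show "2 * (real n)\<^sup>2 * (real n + 1) / (2 * real n - 1) \<le> (real n + 1)\<^sup>2"
      using n by (simp add: divide_le_eq power2_eq_square algebra_simps)
  qed simp
  also have "\<dots> = 2 * (real (Suc n))\<^sup>2 / 2 ^ Suc n * hook_weight [T]"
    by (simp add: add.commute)
  finally show ?case .
qed

section \<open>The logarithm of the hook product\<close>

definition log_sizes :: "unit ptree \<Rightarrow> real" where
  "log_sizes s = fringe_sum (\<lambda>u. ln (real (tree_size u))) [s]"

lemma hook_weight_eq_exp: "hook_weight ts = exp (- fringe_sum (\<lambda>u. ln (real (tree_size u))) ts)"
proof (induction ts rule: forest_induct)
  case (Cons a us ts)
  have "exp (- (ln m + x + y)) = exp (- x) * exp (- y) / m" if "m > 0" for m x y :: real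
    using that by (simp add: exp_add exp_diff exp_minus field_simps)
  then show ?case
    by (simp add: Cons.IH)
qed simp

lemma shape_prob_le:
  "shape_prob T \<le> 2 * (real (tree_size T))\<^sup>2 / 2 ^ tree_size T * exp (- log_sizes T)"
  unfolding shape_prob_def log_sizes_def hook_weight_eq_exp[symmetric]
  using tree_size_ge_1 by (rule PORT_mean_shape_le) simp

text \<open>Telescoping, with a range and weights independent of \<open>m\<close>, so that the same
  combination serves all fringe subtrees of a tree at once.\<close>

lemma ln_eq_sum_increments:
  assumes "1 \<le> m" "m \<le> n"
  shows "ln (real m) = (\<Sum>j=2..n. ln (real j / real (j - 1)) * of_bool (j \<le> m))"
  using assms(2)
proof (induction n rule: dec_induct)
  case base
  have "(\<Sum>j=2..m. ln (real j / real (j - 1)) * of_bool (j \<le> m)) = (\<Sum>j=2..m. ln (real j / real (j - 1)))"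
    by (intro sum.cong) auto
  also have "\<dots> = ln (real m)"
    using assms(1)
  proof (induction m rule: nat_induct_at_least)
    case (Suc m)
    then show ?case by (simp add: sum.nat_ivl_Suc' ln_div)
  qed simp
  finally show ?case ..
next
  case (step n)
  then show ?case
    using assms by (simp add: sum.nat_ivl_Suc')
qed

lemma log_sizes_eq_sum:
  assumes "tree_size s = n"
  shows "log_sizes s = (\<Sum>j=2..n. ln (real j / real (j - 1)) * fringe_count j s)"
proof -
  have "log_sizes s =
      fringe_sum (\<lambda>u. \<Sum>j=2..n. ln (real j / real (j - 1)) * of_bool (j \<le> tree_size u)) [s]"
    unfolding log_sizes_def
    using assms by (intro fringe_sum_cong ln_eq_sum_increments tree_size_ge_1) simp
  then show ?thesis
    by (simp only: fringe_sum_sum fringe_sum_cmult fringe_count_def)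
qed

lemma weighted_sum_square_le:
  fixes w z :: "'i \<Rightarrow> real"
  assumes "\<And>i. i \<in> I \<Longrightarrow> w i \<ge> 0"
  shows "(\<Sum>i\<in>I. w i * z i)\<^sup>2 \<le> (\<Sum>i\<in>I. w i) * (\<Sum>i\<in>I. w i * (z i)\<^sup>2)"
proof -
  have "(\<Sum>i\<in>I. sqrt (w i) * (sqrt (w i) * z i))\<^sup>2 \<le>
      (\<Sum>i\<in>I. (sqrt (w i))\<^sup>2) * (\<Sum>i\<in>I. (sqrt (w i) * z i)\<^sup>2)"
    by (rule Cauchy_Schwarz_ineq_sum)
  moreover have "(\<Sum>i\<in>I. sqrt (w i) * (sqrt (w i) * z i)) = (\<Sum>i\<in>I. w i * z i)"
    "(\<Sum>i\<in>I. (sqrt (w i))\<^sup>2) = (\<Sum>i\<in>I. w i)"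
    "(\<Sum>i\<in>I. (sqrt (w i) * z i)\<^sup>2) = (\<Sum>i\<in>I. w i * (z i)\<^sup>2)"
    using assms by (auto intro!: sum.cong simp: power_mult_distrib simp flip: mult.assoc)
  ultimately show ?thesis by simp
qed

lemma PORT_mean_log_sizes_eq_sum:
  "PORT_mean n log_sizes = (\<Sum>j=2..n. ln (real j / real (j - 1)) * PORT_mean n (fringe_count j))"
proof -
  have "PORT_mean n log_sizes = PORT_mean n (\<lambda>s. \<Sum>j=2..n. ln (real j / real (j - 1)) * fringe_count j s)"
    by (intro PORT_mean_cong log_sizes_eq_sum)
  then show ?thesis
    by (simp only: PORT_mean_sum PORT_mean_cmult)
qed

text \<open>Cauchy-Schwarz with the increments as weights, whose total is \<open>ln n\<close>,
  avoids the covariances of the counts. The lost factor \<open>(ln n)^2\<close> is harmless against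
  the square of a mean of order \<open>n\<close>.\<close>

lemma PORT_var_log_sizes_le:
  assumes "n \<ge> 1"
  shows "PORT_var n log_sizes \<le> (ln (real n))\<^sup>2 * real n / 4"
proof -
  define w where "w j = ln (real j / real (j - 1))" for j :: nat
  have w: "w j \<ge> 0" if "j \<in> {2..n}" for j
    using that by (auto simp: w_def)
  have sum_w: "(\<Sum>j=2..n. w j) = ln (real n)"
    using ln_eq_sum_increments[OF assms order_refl] by (simp add: w_def)
  have "PORT_var n log_sizes \<le>
      PORT_mean n (\<lambda>s. (\<Sum>j=2..n. w j) * (\<Sum>j=2..n. w j * (fringe_count j s - PORT_mean n (fringe_count j))\<^sup>2))"
    unfolding PORT_var_def
  proof (rule PORT_mean_mono)
    fix s :: "unit ptree" assume "tree_size s = n"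
    then have "log_sizes s - PORT_mean n log_sizes =
        (\<Sum>j=2..n. w j * (fringe_count j s - PORT_mean n (fringe_count j)))"
      by (simp add: log_sizes_eq_sum PORT_mean_log_sizes_eq_sum w_def sum_subtractf right_diff_distrib)
    then show "(log_sizes s - PORT_mean n log_sizes)\<^sup>2 \<le>
        (\<Sum>j=2..n. w j) * (\<Sum>j=2..n. w j * (fringe_count j s - PORT_mean n (fringe_count j))\<^sup>2)"
      using w by (simp only: weighted_sum_square_le)
  qed
  also have "\<dots> = ln (real n) * (\<Sum>j=2..n. w j * PORT_var n (fringe_count j))"
    by (simp only: PORT_mean_cmult PORT_mean_sum PORT_var_def sum_w)
  also have "\<dots> \<le> ln (real n) * (\<Sum>j=2..n. w j * (real n / 4))"
    using assms w by (intro mult_left_mono sum_mono PORT_var_fringe_count_le) auto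
  also have "\<dots> = (ln (real n))\<^sup>2 * real n / 4"
    by (simp add: sum_w power2_eq_square flip: sum_divide_distrib sum_distrib_right)
  finally show ?thesis .
qed

text \<open>Summation by parts: \<open>1 / (2 * j - 1) - 1 / (2 * j + 1) = 2 / ((2 * j + 1) * (2 * j
  - 1))\<close> is the origin of the summand in \<open>c13\<close>.\<close>

lemma sum_ln_increments_by_parts:
  assumes "n \<ge> 1"
  shows "(\<Sum>j=2..n. ln (real j / real (j - 1)) / (2 * real j - 1)) =
    2 * (\<Sum>j=1..<n. ln (real j) / ((2 * real j + 1) * (2 * real j - 1))) + ln (real n) / (2 * real n - 1)"
  using assms
proof (induction n rule: nat_induct_at_least)
  case (Suc n)
  have "(\<Sum>j=2..Suc n. ln (real j / real (j - 1)) / (2 * real j - 1)) =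
     (\<Sum>j=2..n. ln (real j / real (j - 1)) / (2 * real j - 1)) + (ln (real (Suc n)) - ln (real n)) / (2 * real n + 1)"
    using Suc.hyps by (simp add: sum.nat_ivl_Suc' ln_div)
  also have "\<dots> = 2 * (\<Sum>j=1..<n. ln (real j) / ((2 * real j + 1) * (2 * real j - 1)))
      + (ln (real n) / (2 * real n - 1) - ln (real n) / (2 * real n + 1)) + ln (real (Suc n)) / (2 * real n + 1)"
    unfolding Suc.IH by (simp add: diff_divide_distrib)
  also have "ln (real n) / (2 * real n - 1) - ln (real n) / (2 * real n + 1) =
      2 * (ln (real n) / ((2 * real n + 1) * (2 * real n - 1)))"
    using Suc.hyps by (simp add: divide_simps) (simp add: algebra_simps)
  finally show ?case
    using Suc.hyps by (simp add: algebra_simps)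
qed simp

lemma PORT_mean_log_sizes:
  assumes "n \<ge> 1"
  shows "PORT_mean n log_sizes =
    (2 * real n - 1) * (\<Sum>j=1..<n. ln (real j) / ((2 * real j + 1) * (2 * real j - 1))) + ln (real n)"
proof -
  have "PORT_mean n log_sizes = (\<Sum>j=2..n. ln (real j / real (j - 1)) / 2
      + (2 * real n - 1) / 2 * (ln (real j / real (j - 1)) / (2 * real j - 1)))"
    unfolding PORT_mean_log_sizes_eq_sum
    by (intro sum.cong refl) (simp add: PORT_mean_fringe_count distrib_left)
  also have "\<dots> = (\<Sum>j=2..n. ln (real j / real (j - 1))) / 2
      + (2 * real n - 1) / 2 * (\<Sum>j=2..n. ln (real j / real (j - 1)) / (2 * real j - 1))"
    by (simp only: sum.distrib sum_distrib_left sum_divide_distrib)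
  also have "(\<Sum>j=2..n. ln (real j / real (j - 1))) = ln (real n)"
    using ln_eq_sum_increments[OF assms order_refl] by simp
  \<comment> \<open>The term \<open>1 / 2\<close> of the mean count and the boundary term of the
    summation by parts contribute \<open>ln n / 2\<close> each.\<close>
  moreover have "(2 * real n - 1) / 2 * (ln (real n) / (2 * real n - 1)) = ln (real n) / 2"
    using assms by (simp add: field_simps)
  ultimately show ?thesis
    unfolding sum_ln_increments_by_parts[OF assms] distrib_left by simp
qed

section \<open>Deterministic bounds for the number of distinct fringe subtrees\<close>

lemma shape_fringe_subtrees: "shape ` fringe_subtrees t = fringe_subtrees (shape t)"
  by (induction t) (auto simp: image_UN)

lemma num_distinct_fringe_shape: "num_distinct_fringe t = card (fringe_subtrees (shape t))"
  by (simp add: num_distinct_fringe_def shape_fringe_subtrees)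

definition forest_fringe :: "'a ptree list \<Rightarrow> 'a ptree set" where
  "forest_fringe ts = (\<Union>t\<in>set ts. fringe_subtrees t)"

lemma forest_fringe_simps [simp]:
  "forest_fringe [] = {}"
  "forest_fringe (Node a us # ts) = insert (Node a us) (forest_fringe us \<union> forest_fringe ts)"
  by (auto simp: forest_fringe_def)

lemma forest_fringe_singleton: "forest_fringe [t] = fringe_subtrees t"
  by (simp add: forest_fringe_def)

lemma card_forest_fringe_le:
  "real (card {u \<in> forest_fringe ts. Q u}) \<le> fringe_sum (\<lambda>u. of_bool (Q u)) ts"
proof (induction ts rule: forest_induct)
  case (Cons a us ts)
  have eq: "{u \<in> forest_fringe (Node a us # ts). Q u} =
      (if Q (Node a us) then {Node a us} else {}) \<union>
      ({u \<in> forest_fringe us. Q u} \<union> {u \<in> forest_fringe ts. Q u})"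
    by auto
  have "card {u \<in> forest_fringe (Node a us # ts). Q u} \<le>
      card (if Q (Node a us) then {Node a us} else {}) +
      (card {u \<in> forest_fringe us. Q u} + card {u \<in> forest_fringe ts. Q u})"
    unfolding eq by (intro order_trans[OF card_Un_le] add_left_mono card_Un_le)
  also have "card (if Q (Node a us) then {Node a us} else {}) = of_bool (Q (Node a us))"
    by simp
  finally have "real (card {u \<in> forest_fringe (Node a us # ts). Q u}) \<le>
      real (of_bool (Q (Node a us)) + (card {u \<in> forest_fringe us. Q u} + card {u \<in> forest_fringe ts. Q u}))"
    by (simp only: of_nat_le_iff)
  then show ?case
    using Cons.IH by simp
qed simp

lemma fringe_sum_shape_eq_0:
  "T \<notin> forest_fringe ts \<Longrightarrow> fringe_sum (\<lambda>u. of_bool (u = T)) ts = 0"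
  by (induction ts rule: forest_induct) auto

lemma fringe_sum_larger_shape_eq_0:
  assumes "forest_size ts < tree_size T"
  shows "fringe_sum (\<lambda>u. of_bool (u = T)) ts = 0"
proof -
  have "fringe_sum (\<lambda>u. of_bool (u = T)) ts = fringe_sum (\<lambda>_. 0) ts"
    using assms by (intro fringe_sum_cong) auto
  then show ?thesis
    by (simp only: fringe_sum_zero)
qed

text \<open>Two copies of one shape have equal size, so neither contains the other: every ordered
  pair of distinct copies is counted.\<close>

lemma pair_sum_shape:
  "pair_sum (\<lambda>u. of_bool (u = T)) (\<lambda>u. of_bool (u = T)) ts =
     (fringe_sum (\<lambda>u. of_bool (u = T)) ts)\<^sup>2 - fringe_sum (\<lambda>u. of_bool (u = T)) ts"
proof (induction ts rule: forest_induct)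
  case (Cons a us ts)
  have "fringe_sum (\<lambda>u. of_bool (u = T)) us = 0" if "Node a us = T"
    using that by (intro fringe_sum_larger_shape_eq_0) auto
  then show ?case
    using Cons.IH by (auto simp: power2_eq_square algebra_simps)
qed simp

text \<open>A Bonferroni bound: a shape with \<open>N\<close> copies contributes
  \<open>N - N * (N - 1) = 1 - (N - 1)^2\<close>, which is at most 1 and is 0 for
  \<open>N = 0\<close>.\<close>

lemma card_fringe_subtrees_ge:
  assumes "finite G"
  shows "real (card (fringe_subtrees s)) \<ge> fringe_sum (\<lambda>u. of_bool (u \<in> G)) [s]
    - (\<Sum>T\<in>G. pair_sum (\<lambda>u. of_bool (u = T)) (\<lambda>u. of_bool (u = T)) [s])"
proof -
  let ?N = "\<lambda>T. fringe_sum (\<lambda>u. of_bool (u = T)) [s]"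
  have "fringe_sum (\<lambda>u. of_bool (u \<in> G)) [s] = fringe_sum (\<lambda>u. \<Sum>T\<in>G. of_bool (u = T)) [s]"
    using assms by (intro fringe_sum_cong) (simp add: of_bool_def)
  also have "\<dots> = (\<Sum>T\<in>G. ?N T)"
    by (rule fringe_sum_sum)
  finally have "fringe_sum (\<lambda>u. of_bool (u \<in> G)) [s]
      - (\<Sum>T\<in>G. pair_sum (\<lambda>u. of_bool (u = T)) (\<lambda>u. of_bool (u = T)) [s]) =
      (\<Sum>T\<in>G. 1 - (?N T - 1)\<^sup>2)"
    by (simp add: pair_sum_shape power2_eq_square algebra_simps flip: sum_subtractf)
  also have "\<dots> \<le> (\<Sum>T\<in>G. of_bool (T \<in> fringe_subtrees s))"
  proof (rule sum_mono)
    fix T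
    show "1 - (?N T - 1)\<^sup>2 \<le> of_bool (T \<in> fringe_subtrees s)"
    proof (cases "T \<in> fringe_subtrees s")
      case False
      then have "?N T = 0"
        by (intro fringe_sum_shape_eq_0) (simp add: forest_fringe_singleton)
      then show ?thesis by simp
    qed simp
  qed
  also have "\<dots> = real (card (G \<inter> fringe_subtrees s))"
    using assms by (simp add: of_bool_def sum.If_cases Int_def)
  also have "\<dots> \<le> real (card (fringe_subtrees s))"
    by (simp add: card_mono finite_fringe_subtrees)
  finally show ?thesis .
qed

section \<open>Dyck words and the number of small shapes\<close>

fun balanced_word :: "unit ptree list \<Rightarrow> bool list" where
  "balanced_word [] = []"
| "balanced_word (Node a us # ts) = True # balanced_word us @ False # balanced_word ts"

lemma length_balanced_word: "length (balanced_word ts) = 2 * forest_size ts"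
  by (induction ts rule: forest_induct) auto

text \<open>The closing \<open>False\<close> delimits the word of a forest. Plain injectivity is not
  inductive, so arbitrary remainders are allowed after the delimiter.\<close>

lemma balanced_word_append_inject:
  "balanced_word us @ False # xs = balanced_word vs @ False # ys \<Longrightarrow> us = vs \<and> xs = ys"
proof (induction us arbitrary: vs xs ys rule: forest_induct)
  case Nil
  then show ?case
    by (cases vs rule: forest_size.cases) auto
next
  case (Cons a us ts)
  show ?case
  proof (cases vs rule: forest_size.cases)
    case 1
    then show ?thesis
      using Cons.prems by simp
  next
    case (2 b us' ts')
    then have "us = us' \<and> balanced_word ts @ False # xs = balanced_word ts' @ False # ys"
      using Cons.prems by (intro Cons.IH(1)) simp
    moreover from this have "ts = ts' \<and> xs = ys"
      by (intro Cons.IH(2)) simp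
    ultimately show ?thesis
      using 2 by simp
  qed
qed

lemma inj_balanced_word: "inj balanced_word"
proof (rule injI)
  fix us vs assume "balanced_word us = balanced_word vs"
  then show "us = vs"
    using balanced_word_append_inject[of us "[]" vs "[]"] by simp
qed

lemma small_shapes:
  assumes "k \<ge> 1"
  shows "finite {T :: unit ptree. tree_size T < k}" "card {T :: unit ptree. tree_size T < k} \<le> 2 * 4 ^ k"
proof -
  let ?S = "{T :: unit ptree. tree_size T < k}"
    and ?W = "{xs. set xs \<subseteq> (UNIV :: bool set) \<and> length xs \<le> 2 * k}"
  have sub: "(\<lambda>T. balanced_word [T]) ` ?S \<subseteq> ?W"
    by (auto simp only: mem_Collect_eq length_balanced_word subset_UNIV)
  have inj: "inj_on (\<lambda>T. balanced_word [T]) ?S"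
    by (rule inj_onI) (use injD[OF inj_balanced_word] in blast)
  have fin: "finite ?W"
    by (rule finite_lists_length_le) simp
  show "finite ?S"
    using inj_on_finite[OF inj sub fin] .
  have "card ?S \<le> card ?W"
    using card_inj_on_le[OF inj sub fin] .
  also have "\<dots> = (\<Sum>i\<le>2 * k. 2 ^ i)"
    by (subst card_lists_length_le) simp_all
  also have "\<dots> < 2 ^ Suc (2 * k)"
  proof -
    have "(\<Sum>i\<le>m. 2 ^ i :: nat) < 2 ^ Suc m" for m
      by (induction m) auto
    then show ?thesis .
  qed
  finally show "card ?S \<le> 2 * 4 ^ k"
    by (simp add: power_mult)
qed

lemma card_fringe_subtrees_le:
  assumes "k \<ge> 1"
  shows "real (card (fringe_subtrees s)) \<le> 2 * 4 ^ k + fringe_count k s"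
proof -
  have "fringe_subtrees s \<subseteq> {T. tree_size T < k} \<union> {u \<in> fringe_subtrees s. k \<le> tree_size u}"
    by auto
  then have "card (fringe_subtrees s) \<le> card ({T :: unit ptree. tree_size T < k} \<union> {u \<in> fringe_subtrees s. k \<le> tree_size u})"
    by (intro card_mono finite_UnI small_shapes assms) (simp_all add: finite_fringe_subtrees)
  also have "\<dots> \<le> 2 * 4 ^ k + card {u \<in> fringe_subtrees s. k \<le> tree_size u}"
    using small_shapes(2)[OF assms] by (intro order_trans[OF card_Un_le] add_mono) auto
  finally have "real (card (fringe_subtrees s)) \<le> real (2 * 4 ^ k + card {u \<in> fringe_subtrees s. k \<le> tree_size u})"
    by (simp only: of_nat_le_iff)
  then show ?thesis
    using card_forest_fringe_le[of "[s]" "\<lambda>u. k \<le> tree_size u"]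
    by (simp add: fringe_count_def forest_fringe_singleton)
qed

section \<open>The upper bounds\<close>

definition PORT_prob :: "nat \<Rightarrow> (unit ptree \<Rightarrow> bool) \<Rightarrow> real" where
  "PORT_prob n Q = PORT_mean n (\<lambda>s. of_bool (Q s))"

lemma PORT_prob_nonneg: "PORT_prob n Q \<ge> 0"
  unfolding PORT_prob_def by (rule PORT_mean_nonneg) simp

lemma PORT_prob_le_1: "n \<ge> 1 \<Longrightarrow> PORT_prob n Q \<le> 1"
  unfolding PORT_prob_def
  by (subst PORT_mean_const[of n 1, symmetric]) (auto intro: PORT_mean_mono)

lemma PORT_prob_mono:
  assumes "\<And>s. tree_size s = n \<Longrightarrow> P s \<Longrightarrow> Q s"
  shows "PORT_prob n P \<le> PORT_prob n Q"
  unfolding PORT_prob_def using assms by (intro PORT_mean_mono) auto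

lemma PORT_prob_disj_le: "PORT_prob n (\<lambda>s. P s \<or> Q s) \<le> PORT_prob n P + PORT_prob n Q"
  unfolding PORT_prob_def PORT_mean_add[symmetric] by (intro PORT_mean_mono) auto

lemma PORT_prob_not: "n \<ge> 1 \<Longrightarrow> PORT_prob n (\<lambda>s. \<not> P s) = 1 - PORT_prob n P"
  unfolding PORT_prob_def using PORT_mean_const[of n 1]
  by (simp add: of_bool_not_iff PORT_mean_diff)

lemma PORT_prob_Markov:
  assumes "\<And>s. \<phi> s \<ge> 0" "a > 0"
  shows "PORT_prob n (\<lambda>s. \<phi> s \<ge> a) \<le> PORT_mean n \<phi> / a"
proof -
  have "PORT_prob n (\<lambda>s. \<phi> s \<ge> a) \<le> PORT_mean n (\<lambda>s. (1 / a) * \<phi> s)"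
    unfolding PORT_prob_def using assms by (intro PORT_mean_mono) (auto simp: field_simps)
  then show ?thesis
    by (simp only: PORT_mean_cmult) simp
qed

lemma PORT_prob_Chebyshev:
  assumes "a > 0"
  shows "PORT_prob n (\<lambda>s. \<bar>\<phi> s - PORT_mean n \<phi>\<bar> \<ge> a) \<le> PORT_var n \<phi> / a\<^sup>2"
proof -
  have "PORT_prob n (\<lambda>s. \<bar>\<phi> s - PORT_mean n \<phi>\<bar> \<ge> a) = PORT_prob n (\<lambda>s. (\<phi> s - PORT_mean n \<phi>)\<^sup>2 \<ge> a\<^sup>2)"
    using assms by (simp add: abs_le_square_iff[symmetric])
  also have "\<dots> \<le> PORT_var n \<phi> / a\<^sup>2"
    unfolding PORT_var_def using assms by (intro PORT_prob_Markov) auto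
  finally show ?thesis .
qed

lemma expectation_random_PORT:
  assumes "n \<ge> 1"
  shows "measure_pmf.expectation (random_PORT n) (\<lambda>t. real (num_distinct_fringe t)) =
    PORT_mean n (\<lambda>s. real (card (fringe_subtrees s)))"
  using assms
  by (simp add: random_PORT_def integral_pmf_of_set finite_PORTs PORTs_nonempty PORT_mean_def
      num_distinct_fringe_shape)

lemma prob_random_PORT:
  assumes "n \<ge> 1"
  shows "measure_pmf.prob (random_PORT n) {t. Q (num_distinct_fringe t)} =
    PORT_prob n (\<lambda>s. Q (card (fringe_subtrees s)))"
  using assms
  by (simp add: random_PORT_def measure_pmf_of_set finite_PORTs PORTs_nonempty PORT_prob_def PORT_mean_def
      num_distinct_fringe_shape of_bool_def sum.If_cases Int_def)

section \<open>Logarithmic size thresholds\<close>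

abbreviation rate :: "nat \<Rightarrow> real" where
  "rate n \<equiv> real n / ln (real n)"

definition log_threshold :: "real \<Rightarrow> nat \<Rightarrow> nat" where
  "log_threshold b n = nat \<lceil>b * ln (real n)\<rceil>"

lemma log_threshold_bounds:
  assumes "b > 0" "n \<ge> 1"
  shows "b * ln (real n) \<le> real (log_threshold b n)" "real (log_threshold b n) \<le> b * ln (real n) + 1"
proof -
  have "b * ln (real n) \<ge> 0"
    using assms by simp
  then show "b * ln (real n) \<le> real (log_threshold b n)" "real (log_threshold b n) \<le> b * ln (real n) + 1"
    unfolding log_threshold_def by linarith+
qed

lemma eventually_log_threshold_ge:
  assumes "b > 0"
  shows "\<forall>\<^sub>F n in sequentially. log_threshold b n \<ge> K"
proof -
  have "filterlim (\<lambda>n. b * ln (real n)) at_top sequentially"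
    using assms by real_asymp
  then have "\<forall>\<^sub>F n in sequentially. b * ln (real n) \<ge> real K"
    by (simp add: filterlim_at_top)
  then show ?thesis
    using eventually_ge_at_top[of 1]
  proof eventually_elim
    case (elim n)
    then have "real K \<le> real (log_threshold b n)"
      using log_threshold_bounds(1)[OF assms elim(2)] by linarith
    then show ?case by simp
  qed
qed

lemma eventually_log_threshold_le:
  assumes "b > 0"
  shows "\<forall>\<^sub>F n in sequentially. log_threshold b n \<le> n"
proof -
  have "\<forall>\<^sub>F n in sequentially. b * ln (real n) + 1 \<le> real n"
    using assms by real_asymp
  then show ?thesis
    using eventually_ge_at_top[of 1]
  proof eventually_elim
    case (elim n)
    then have "real (log_threshold b n) \<le> real n"
      using log_threshold_bounds(2)[OF assms elim(2)] by linarith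
    then show ?case by simp
  qed
qed

lemma eventually_rate_pos: "\<forall>\<^sub>F n in sequentially. rate n > 0"
  by real_asymp

text \<open>The closed form decreases in a real threshold from 1 on, so the rounded threshold is
  caught between its values at \<open>b * ln n\<close> and \<open>b * ln n + 1\<close>, which have
  the same limit.\<close>

lemma tendsto_PORT_mean_fringe_count:
  assumes "b > 0"
  shows "(\<lambda>n. PORT_mean n (fringe_count (log_threshold b n)) / rate n) \<longlonglongrightarrow> 1 / (2 * b)"
proof (rule tendsto_sandwich)
  let ?f = "\<lambda>n x. (1 / 2 + (2 * real n - 1) / (2 * (2 * x - 1))) / rate n"
  have "filterlim (\<lambda>n. b * ln (real n)) at_top sequentially"
    using assms by real_asymp
  then have large: "\<forall>\<^sub>F n in sequentially. b * ln (real n) \<ge> 1"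
    by (simp add: filterlim_at_top)
  have mono: "?f n y \<le> ?f n x" if "1 \<le> x" "x \<le> y" "n \<ge> 1" "rate n > 0" for n x y
    using that by (intro divide_right_mono add_left_mono divide_left_mono) auto
  have ev: "\<forall>\<^sub>F n in sequentially. ?f n (b * ln (real n) + 1) \<le> PORT_mean n (fringe_count (log_threshold b n)) / rate n
      \<and> PORT_mean n (fringe_count (log_threshold b n)) / rate n \<le> ?f n (b * ln (real n))"
    using large eventually_log_threshold_ge[OF assms, of 1] eventually_log_threshold_le[OF assms]
      eventually_rate_pos eventually_ge_at_top[of 1]
  proof eventually_elim
    case (elim n)
    have eq: "PORT_mean n (fringe_count (log_threshold b n)) = 1 / 2 + (2 * real n - 1) / (2 * (2 * real (log_threshold b n) - 1))"
      by (rule PORT_mean_fringe_count[OF elim(2,3)])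
    show ?case
      unfolding eq using elim(1) log_threshold_bounds[OF assms elim(5)]
      by (intro conjI mono elim(4,5)) linarith+
  qed
  show "\<forall>\<^sub>F n in sequentially. ?f n (b * ln (real n) + 1) \<le> PORT_mean n (fringe_count (log_threshold b n)) / rate n"
    using ev by eventually_elim blast
  show "\<forall>\<^sub>F n in sequentially. PORT_mean n (fringe_count (log_threshold b n)) / rate n \<le> ?f n (b * ln (real n))"
    using ev by eventually_elim blast
  have half: "1 / (2 * b) = inverse b / 2"
    by (simp add: field_simps)
  show "(\<lambda>n. ?f n (b * ln (real n) + 1)) \<longlonglongrightarrow> 1 / (2 * b)"
    unfolding half using assms by real_asymp
  show "(\<lambda>n. ?f n (b * ln (real n))) \<longlonglongrightarrow> 1 / (2 * b)"
    unfolding half using assms by real_asymp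
qed

lemma tendsto_0_nonneg_bound:
  fixes f g :: "nat \<Rightarrow> real"
  assumes "g \<longlonglongrightarrow> 0" "\<forall>\<^sub>F n in sequentially. f n \<le> g n" "\<And>n. f n \<ge> 0"
  shows "f \<longlonglongrightarrow> 0"
  using assms by (intro tendsto_sandwich[OF _ assms(2) tendsto_const assms(1)]) auto

text \<open>Chebyshev: the variance is at most \<open>n / 4\<close>, the squared deviation of order
  \<open>(n / ln n)^2\<close>. Half of \<open>\<delta>\<close> is spent on replacing the mean by its
  limit.\<close>

lemma tendsto_fringe_count_deviation:
  assumes "b > 0" "\<delta> > 0"
  shows "(\<lambda>n. PORT_prob n (\<lambda>s. \<bar>fringe_count (log_threshold b n) s - 1 / (2 * b) * rate n\<bar> \<ge> \<delta> * rate n)) \<longlonglongrightarrow> 0"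
proof (rule tendsto_0_nonneg_bound)
  let ?m = "\<lambda>n. PORT_mean n (fringe_count (log_threshold b n))"
  have "\<forall>\<^sub>F n in sequentially. \<bar>?m n / rate n - 1 / (2 * b)\<bar> < \<delta> / 2"
    using tendstoD[OF tendsto_PORT_mean_fringe_count[OF assms(1)], of "\<delta> / 2"] assms(2)
    by (simp add: dist_real_def)
  then show "\<forall>\<^sub>F n in sequentially.
      PORT_prob n (\<lambda>s. \<bar>fringe_count (log_threshold b n) s - 1 / (2 * b) * rate n\<bar> \<ge> \<delta> * rate n)
      \<le> (real n / 4) / (\<delta> / 2 * rate n)\<^sup>2"
    using eventually_rate_pos eventually_log_threshold_ge[OF assms(1), of 1] eventually_ge_at_top[of 1]
  proof eventually_elim
    case (elim n)
    define r k m where "r = rate n" and "k = log_threshold b n" and "m = ?m n"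
    have r: "r > 0" and near: "\<bar>m / r - 1 / (2 * b)\<bar> < \<delta> / 2"
      using elim by (simp_all add: r_def m_def)
    have "\<bar>m - 1 / (2 * b) * r\<bar> = \<bar>m / r - 1 / (2 * b)\<bar> * r"
      using r by (simp add: abs_mult_pos left_diff_distrib)
    also have "\<dots> < \<delta> / 2 * r"
      using near r by (rule mult_strict_right_mono)
    finally have near': "\<bar>m - 1 / (2 * b) * r\<bar> < \<delta> / 2 * r" .
    have triangle: "\<bar>x - y\<bar> \<ge> d" if "\<bar>x - p\<bar> \<ge> D" "\<bar>y - p\<bar> < d" "D = d + d" for x y p d D :: real
      using that by linarith
    have "PORT_prob n (\<lambda>s. \<bar>fringe_count k s - 1 / (2 * b) * r\<bar> \<ge> \<delta> * r)
        \<le> PORT_prob n (\<lambda>s. \<bar>fringe_count k s - PORT_mean n (fringe_count k)\<bar> \<ge> \<delta> / 2 * r)"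
    proof (rule PORT_prob_mono)
      fix s assume "\<bar>fringe_count k s - 1 / (2 * b) * r\<bar> \<ge> \<delta> * r"
      then have "\<bar>fringe_count k s - m\<bar> \<ge> \<delta> / 2 * r"
        by (rule triangle[OF _ near']) (simp add: field_simps)
      then show "\<bar>fringe_count k s - PORT_mean n (fringe_count k)\<bar> \<ge> \<delta> / 2 * r"
        by (simp only: m_def k_def)
    qed
    also have "\<dots> \<le> PORT_var n (fringe_count k) / (\<delta> / 2 * r)\<^sup>2"
      using assms r by (intro PORT_prob_Chebyshev) simp
    also have "\<dots> \<le> (real n / 4) / (\<delta> / 2 * r)\<^sup>2"
      using elim by (intro divide_right_mono PORT_var_fringe_count_le) (simp_all add: k_def)
    finally show ?case
      by (simp only: r_def k_def)
  qed
  show "(\<lambda>n. (real n / 4) / (\<delta> / 2 * rate n)\<^sup>2) \<longlonglongrightarrow> 0"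
    using assms by real_asymp
qed (rule PORT_prob_nonneg)

text \<open>\<open>4 ^ k\<close> is about \<open>n powr (b * ln 4)\<close>, with exponent below 1;
  rounding the threshold costs at most a factor 4.\<close>

lemma small_shapes_negligible:
  assumes "b > 0" "b * ln 4 < 1"
  shows "(\<lambda>n. 2 * 4 ^ log_threshold b n / rate n) \<longlonglongrightarrow> 0"
proof (rule tendsto_sandwich[of "\<lambda>_. 0" _ _ "\<lambda>n. 8 * real n powr (b * ln 4) / rate n"])
  show "\<forall>\<^sub>F n in sequentially. 0 \<le> 2 * 4 ^ log_threshold b n / rate n"
    using eventually_rate_pos by eventually_elim (rule divide_nonneg_pos, simp)
  show "\<forall>\<^sub>F n in sequentially. 2 * 4 ^ log_threshold b n / rate n \<le> 8 * real n powr (b * ln 4) / rate n"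
    using eventually_rate_pos eventually_ge_at_top[of 1]
  proof eventually_elim
    case (elim n)
    have "(4 :: real) ^ log_threshold b n = 4 powr real (log_threshold b n)"
      by (simp add: powr_realpow)
    also have "\<dots> \<le> 4 powr (b * ln (real n) + 1)"
      using log_threshold_bounds[OF assms(1) elim(2)] by (intro powr_mono) auto
    also have "\<dots> = 4 * real n powr (b * ln 4)"
      using elim by (simp add: powr_def exp_add algebra_simps)
    finally have "2 * (4 :: real) ^ log_threshold b n \<le> 8 * real n powr (b * ln 4)"
      by simp
    then show ?case
      using elim(1) by (intro divide_right_mono) linarith+
  qed
  show "(\<lambda>n. 8 * real n powr (b * ln 4) / rate n) \<longlonglongrightarrow> 0"
    using assms by real_asymp
qed simp

lemma upper_bounds:
  assumes "c > c14"
  shows "\<forall>\<^sub>F n in sequentially. PORT_mean n (\<lambda>s. real (card (fringe_subtrees s))) \<le> c * rate n"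
    and "(\<lambda>n. PORT_prob n (\<lambda>s. real (card (fringe_subtrees s)) > c * rate n)) \<longlonglongrightarrow> 0"
proof -
  \<comment> \<open>\<open>b\<close> makes the limit \<open>1 / (2 * b)\<close> of the normalised
    count equal to \<open>c'\<close>; then \<open>b * ln 4 = c14 / c'\<close>, which is below 1
    exactly because \<open>c' > c14\<close>.\<close>
  define c' b where "c' = (c + c14) / 2" and "b = 1 / (2 * c')"
  define k where "k = log_threshold b"
  have "c14 > 0" by (simp add: c14_def)
  then have c': "c14 < c'" "c' < c" "c' > 0"
    using assms by (auto simp: c'_def)
  have b: "b > 0" "1 / (2 * b) = c'"
    using c' by (auto simp: b_def)
  have "ln (4 :: real) = 2 * c14"
    using ln_realpow[of 2 2] by (simp add: c14_def)
  then have "b * ln 4 < 1"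
    using c' by (simp add: b_def)
  note small = small_shapes_negligible[OF b(1) this, folded k_def]
  note count = tendsto_PORT_mean_fringe_count[OF b(1), folded k_def, unfolded b(2)]
  have k1: "\<forall>\<^sub>F n in sequentially. k n \<ge> 1"
    unfolding k_def by (rule eventually_log_threshold_ge[OF b(1)])
  have "(\<lambda>n. 2 * 4 ^ k n / rate n + PORT_mean n (fringe_count (k n)) / rate n) \<longlonglongrightarrow> 0 + c'"
    by (intro tendsto_add small count)
  then have "\<forall>\<^sub>F n in sequentially. 2 * 4 ^ k n / rate n + PORT_mean n (fringe_count (k n)) / rate n < c"
    using c' by (intro order_tendstoD) auto
  then show "\<forall>\<^sub>F n in sequentially. PORT_mean n (\<lambda>s. real (card (fringe_subtrees s))) \<le> c * rate n"
    using k1 eventually_rate_pos eventually_ge_at_top[of 1]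
  proof eventually_elim
    case (elim n)
    have "PORT_mean n (\<lambda>s. real (card (fringe_subtrees s))) \<le> PORT_mean n (\<lambda>s. 2 * 4 ^ k n + fringe_count (k n) s)"
      using elim by (intro PORT_mean_mono card_fringe_subtrees_le)
    also have "\<dots> = 2 * 4 ^ k n + PORT_mean n (fringe_count (k n))"
      using elim by (simp only: PORT_mean_add PORT_mean_const)
    also have "\<dots> < c * rate n"
      using elim(1,3) by (simp only: add_divide_distrib[symmetric] pos_divide_less_eq)
    finally show ?case by simp
  qed
  define \<delta> where "\<delta> = (c - c') / 2"
  have \<delta>: "\<delta> > 0" "c = c' + \<delta> + \<delta>"
    using c' by (auto simp: \<delta>_def)
  have "\<forall>\<^sub>F n in sequentially. 2 * 4 ^ k n / rate n < \<delta>"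
    using small \<delta> by (intro order_tendstoD) auto
  then have "\<forall>\<^sub>F n in sequentially. PORT_prob n (\<lambda>s. real (card (fringe_subtrees s)) > c * rate n) \<le>
      PORT_prob n (\<lambda>s. \<bar>fringe_count (k n) s - c' * rate n\<bar> \<ge> \<delta> * rate n)"
    using k1 eventually_rate_pos
  proof eventually_elim
    case (elim n)
    have 4: "2 * 4 ^ k n < \<delta> * rate n"
      using elim(1,3) by (simp only: pos_divide_less_eq)
    show ?case
    proof (rule PORT_prob_mono)
      fix s :: "unit ptree" assume "real (card (fringe_subtrees s)) > c * rate n"
      then have "c * rate n < 2 * 4 ^ k n + fringe_count (k n) s"
        using card_fringe_subtrees_le[OF elim(2), of s] by linarith
      then have "\<delta> * rate n \<le> fringe_count (k n) s - c' * rate n"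
        using 4 unfolding \<delta>(2) distrib_right by linarith
      then show "\<bar>fringe_count (k n) s - c' * rate n\<bar> \<ge> \<delta> * rate n"
        by linarith
    qed
  qed
  then show "(\<lambda>n. PORT_prob n (\<lambda>s. real (card (fringe_subtrees s)) > c * rate n)) \<longlonglongrightarrow> 0"
    by (rule tendsto_0_nonneg_bound[OF
          tendsto_fringe_count_deviation[OF b(1) \<delta>(1), folded k_def, unfolded b(2)] _ PORT_prob_nonneg])
qed

section \<open>Typical shapes\<close>

definition mean_log_size :: real where
  "mean_log_size = 2 * (\<Sum>j. let k = real (Suc j) in ln k / ((2 * k + 1) * (2 * k - 1)))"

text \<open>The two parts of the decay rate of a typical shape probability: \<open>ln 2\<close> from
  the factor \<open>2 ^ (- k)\<close>, the rest from the hook product.\<close>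

lemma c13_eq: "2 * c13 = ln 2 + mean_log_size"
  by (simp add: c13_def mean_log_size_def)

lemma c13_pos: "c13 > 0"
proof -
  have "(\<Sum>j. let k = real (Suc j) in ln k / ((2 * k + 1) * (2 * k - 1))) \<ge> 0"
    by (intro suminf_nonneg summable_c13) (simp add: Let_def)
  moreover have "ln (2 :: real) > 0" by simp
  ultimately show ?thesis
    unfolding c13_def by linarith
qed

lemma tendsto_PORT_mean_log_sizes:
  "(\<lambda>n. PORT_mean n log_sizes / real n) \<longlonglongrightarrow> mean_log_size"
proof -
  let ?f = "\<lambda>j. let k = real (Suc j) in ln k / ((2 * k + 1) * (2 * k - 1))"
  let ?S = "\<lambda>n. \<Sum>j=1..<n. ln (real j) / ((2 * real j + 1) * (2 * real j - 1))"
  have shift: "?S n = (\<Sum>j<n - 1. ?f j)" if "n \<ge> 1" for n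
  proof -
    have "?S n = (\<Sum>j=Suc 0..<Suc (n - 1). ln (real j) / ((2 * real j + 1) * (2 * real j - 1)))"
      using that by simp
    also have "\<dots> = (\<Sum>j=0..<n - 1. ?f j)"
      by (simp only: sum.shift_bounds_Suc_ivl Let_def)
    finally show ?thesis
      by (simp only: atLeast0LessThan)
  qed
  have "(\<lambda>n. \<Sum>j<n. ?f j) \<longlonglongrightarrow> mean_log_size / 2"
    using summable_LIMSEQ[OF summable_c13] by (simp add: mean_log_size_def)
  moreover have "filterlim (\<lambda>n :: nat. n - 1) at_top sequentially"
    by (rule filterlim_minus_const_nat_at_top)
  ultimately have "(\<lambda>n. \<Sum>j<n - 1. ?f j) \<longlonglongrightarrow> mean_log_size / 2"
    by (rule filterlim_compose)
  moreover have "\<forall>\<^sub>F n in sequentially. (\<Sum>j<n - 1. ?f j) = ?S n"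
    using eventually_ge_at_top[of 1] by eventually_elim (rule shift[symmetric])
  ultimately have S: "?S \<longlonglongrightarrow> mean_log_size / 2"
    by (rule Lim_transform_eventually)
  have "(\<lambda>n. (2 * real n - 1) / real n * ?S n + ln (real n) / real n) \<longlonglongrightarrow> 2 * (mean_log_size / 2) + 0"
  proof (intro tendsto_add tendsto_mult S)
    show "(\<lambda>n. (2 * real n - 1) / real n) \<longlonglongrightarrow> 2" by real_asymp
    show "(\<lambda>n. ln (real n) / real n) \<longlonglongrightarrow> 0" by real_asymp
  qed
  then have "(\<lambda>n. (2 * real n - 1) / real n * ?S n + ln (real n) / real n) \<longlonglongrightarrow> mean_log_size"
    by simp
  moreover have "\<forall>\<^sub>F n in sequentially.
      (2 * real n - 1) / real n * ?S n + ln (real n) / real n = PORT_mean n log_sizes / real n"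
    using eventually_ge_at_top[of 1]
    by eventually_elim (simp only: PORT_mean_log_sizes add_divide_distrib times_divide_eq_left)
  ultimately show ?thesis
    by (rule Lim_transform_eventually)
qed

text \<open>One-sided on purpose: only an unusually small hook product makes a shape too
  probable.\<close>

definition atypical :: "real \<Rightarrow> unit ptree \<Rightarrow> bool" where
  "atypical \<eta> T \<longleftrightarrow> log_sizes T < (mean_log_size - \<eta>) * real (tree_size T)"

lemma tendsto_PORT_prob_atypical:
  assumes "\<eta> > 0"
  shows "(\<lambda>n. PORT_prob n (atypical \<eta>)) \<longlonglongrightarrow> 0"
proof (rule tendsto_0_nonneg_bound)
  have "\<forall>\<^sub>F n in sequentially. PORT_mean n log_sizes / real n > mean_log_size - \<eta> / 2"
    using assms by (intro order_tendstoD[OF tendsto_PORT_mean_log_sizes]) simp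
  then show "\<forall>\<^sub>F n in sequentially. PORT_prob n (atypical \<eta>) \<le>
      ((ln (real n))\<^sup>2 * real n / 4) / (\<eta> / 2 * real n)\<^sup>2"
    using eventually_ge_at_top[of 1]
  proof eventually_elim
    case (elim n)
    then have mean: "PORT_mean n log_sizes > (mean_log_size - \<eta> / 2) * real n"
      by (simp add: field_simps)
    have "PORT_prob n (atypical \<eta>) \<le> PORT_prob n (\<lambda>s. \<bar>log_sizes s - PORT_mean n log_sizes\<bar> \<ge> \<eta> / 2 * real n)"
    proof (rule PORT_prob_mono)
      fix s assume s: "tree_size s = n" "atypical \<eta> s"
      have "(mean_log_size - \<eta> / 2) * real n = (mean_log_size - \<eta>) * real n + \<eta> / 2 * real n"
        by (simp add: field_simps)
      then show "\<bar>log_sizes s - PORT_mean n log_sizes\<bar> \<ge> \<eta> / 2 * real n"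
        using mean s(2) unfolding atypical_def s(1) by linarith
    qed
    also have "\<dots> \<le> PORT_var n log_sizes / (\<eta> / 2 * real n)\<^sup>2"
      using assms elim by (intro PORT_prob_Chebyshev) simp
    also have "\<dots> \<le> ((ln (real n))\<^sup>2 * real n / 4) / (\<eta> / 2 * real n)\<^sup>2"
      using elim by (intro divide_right_mono PORT_var_log_sizes_le) auto
    finally show ?case .
  qed
  show "(\<lambda>n. ((ln (real n))\<^sup>2 * real n / 4) / (\<eta> / 2 * real n)\<^sup>2) \<longlonglongrightarrow> 0"
    using assms by real_asymp
qed (rule PORT_prob_nonneg)

text \<open>Here \<open>\<beta> = 2 * c13 - 2 * \<eta>\<close>: one \<open>\<eta>\<close> absorbs
  the polynomial factor, the other the tolerance in \<open>atypical\<close>. With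
  \<open>\<beta> >= 0\<close> the bound at \<open>k\<close> also covers all larger shapes.\<close>

lemma shape_prob_typical_le:
  assumes "0 \<le> \<beta>" "\<beta> < 2 * c13" "\<eta> = (2 * c13 - \<beta>) / 2"
  shows "\<forall>\<^sub>F k in sequentially. \<forall>T. k \<le> tree_size T \<longrightarrow> \<not> atypical \<eta> T \<longrightarrow>
    shape_prob T \<le> exp (- \<beta> * real k)"
proof -
  have \<eta>: "\<eta> > 0" using assms by simp
  have "\<forall>\<^sub>F k in sequentially. 2 * (real k)\<^sup>2 \<le> exp (\<eta> * real k)"
    using \<eta> by real_asymp
  then obtain K where K: "\<And>k. k \<ge> K \<Longrightarrow> 2 * (real k)\<^sup>2 \<le> exp (\<eta> * real k)"
    by (auto simp: eventually_sequentially)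
  have "shape_prob T \<le> exp (- \<beta> * real k)"
    if "k \<ge> K" "k \<le> tree_size T" "\<not> atypical \<eta> T" for k T
  proof -
    define m where "m = tree_size T"
    have "shape_prob T \<le> 2 * (real m)\<^sup>2 / 2 ^ m * exp (- log_sizes T)"
      unfolding m_def by (rule shape_prob_le)
    also have "\<dots> \<le> exp (\<eta> * real m) / 2 ^ m * exp (- ((mean_log_size - \<eta>) * real m))"
      using that K[of m] by (intro mult_mono divide_right_mono) (auto simp: atypical_def m_def)
    also have "(2 :: real) ^ m = exp (real m * ln 2)"
      by (simp add: exp_of_nat_mult)
    also have "exp (\<eta> * real m) / exp (real m * ln 2) * exp (- ((mean_log_size - \<eta>) * real m)) =
        exp (- (ln 2 + mean_log_size - 2 * \<eta>) * real m)"
      by (simp add: algebra_simps flip: exp_diff exp_add)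
    also have "ln 2 + mean_log_size - 2 * \<eta> = \<beta>"
      using c13_eq assms(3) by simp
    also have "exp (- \<beta> * real m) \<le> exp (- \<beta> * real k)"
      using that assms(1) by (simp add: m_def mult_left_mono del: forest_size.simps)
    finally show ?thesis .
  qed
  then show ?thesis
    by (intro eventually_mono[OF eventually_ge_at_top[of K]]) blast
qed

section \<open>Losses from repeated and from atypical fringe subtrees\<close>

definition repeated_pairs :: "unit ptree set \<Rightarrow> unit ptree \<Rightarrow> real" where
  "repeated_pairs G s = (\<Sum>T\<in>G. pair_sum (\<lambda>u. of_bool (u = T)) (\<lambda>u. of_bool (u = T)) [s])"

lemma repeated_pairs_nonneg: "repeated_pairs G s \<ge> 0"
  unfolding repeated_pairs_def by (intro sum_nonneg pair_sum_nonneg) auto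

text \<open>Each fringe subtree is a copy of at most one shape in \<open>G\<close>, so the sum over
  \<open>G\<close> is bounded by the number \<open>n\<close> of fringe subtrees, whatever the
  cardinality of \<open>G\<close>.\<close>

lemma PORT_mean_repeated_pairs_le:
  assumes "n \<ge> 1" "finite G" "\<And>T. T \<in> G \<Longrightarrow> shape_prob T \<le> q" "q \<ge> 0"
  shows "PORT_mean n (repeated_pairs G) \<le> q * (real n)\<^sup>2"
proof -
  let ?I = "\<lambda>T u. of_bool (u = T) :: real"
  have "PORT_mean n (repeated_pairs G) = (\<Sum>T\<in>G. PORT_mean n (\<lambda>s. pair_sum (?I T) (?I T) [s]))"
    unfolding repeated_pairs_def[abs_def] by (rule PORT_mean_sum)
  also have "\<dots> \<le> (\<Sum>T\<in>G. q * (real n * PORT_mean n (\<lambda>s. fringe_sum (?I T) [s])))"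
  proof (rule sum_mono)
    fix T assume "T \<in> G"
    have "PORT_mean n (\<lambda>s. pair_sum (?I T) (?I T) [s]) \<le>
        shape_prob T * (real n * PORT_mean n (\<lambda>s. fringe_sum (?I T) [s]))"
      by (rule PORT_mean_pair_sum_shape_le[OF assms(1)])
    also have "\<dots> \<le> q * (real n * PORT_mean n (\<lambda>s. fringe_sum (?I T) [s]))"
      using assms(3)[OF \<open>T \<in> G\<close>]
      by (intro mult_right_mono mult_nonneg_nonneg PORT_mean_nonneg fringe_sum_nonneg) auto
    finally show "PORT_mean n (\<lambda>s. pair_sum (?I T) (?I T) [s]) \<le>
        q * (real n * PORT_mean n (\<lambda>s. fringe_sum (?I T) [s]))" .
  qed
  also have "\<dots> = q * (real n * PORT_mean n (\<lambda>s. fringe_sum (\<lambda>u. \<Sum>T\<in>G. ?I T u) [s]))"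
    by (simp only: fringe_sum_sum PORT_mean_sum sum_distrib_left)
  also have "PORT_mean n (\<lambda>s. fringe_sum (\<lambda>u. \<Sum>T\<in>G. ?I T u) [s]) \<le> PORT_mean n (\<lambda>s. real n)"
  proof (rule PORT_mean_mono)
    fix s :: "unit ptree" assume s: "tree_size s = n"
    have "fringe_sum (\<lambda>u. \<Sum>T\<in>G. ?I T u) [s] \<le> fringe_sum (\<lambda>_. 1) [s]"
      using assms(2) by (intro fringe_sum_mono) (simp add: of_bool_def)
    then show "fringe_sum (\<lambda>u. \<Sum>T\<in>G. ?I T u) [s] \<le> real n"
      by (simp only: fringe_sum_one s)
  qed
  also have "PORT_mean n (\<lambda>s. real n) = real n"
    by (rule PORT_mean_const[OF assms(1)])
  finally show ?thesis
    using assms(4) by (simp add: power2_eq_square mult_left_mono)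
qed

definition atypical_count :: "real \<Rightarrow> nat \<Rightarrow> unit ptree \<Rightarrow> real" where
  "atypical_count \<eta> k s = fringe_sum (\<lambda>u. of_bool (k \<le> tree_size u \<and> atypical \<eta> u)) [s]"

lemma atypical_count_nonneg: "atypical_count \<eta> k s \<ge> 0"
  unfolding atypical_count_def by (rule fringe_sum_nonneg) simp

lemma PORT_mean_atypical_count_le:
  assumes "n \<ge> 1" "\<And>m. m \<ge> k \<Longrightarrow> PORT_prob m (atypical \<eta>) \<le> e" "e \<ge> 0"
  shows "PORT_mean n (atypical_count \<eta> k) \<le> e * PORT_mean n (fringe_count k)"
proof -
  have "PORT_mean n (atypical_count \<eta> k) =
      PORT_mean n (\<lambda>s. fringe_sum (\<lambda>u. PORT_mean (tree_size u)
        (\<lambda>u. of_bool (k \<le> tree_size u \<and> atypical \<eta> u))) [s])"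
    unfolding atypical_count_def[abs_def] by (rule PORT_mean_fringe_sum_conditional[OF assms(1)])
  also have "\<dots> \<le> PORT_mean n (\<lambda>s. e * fringe_count k s)"
    unfolding fringe_count_def fringe_sum_cmult[symmetric]
  proof (intro PORT_mean_mono fringe_sum_mono)
    fix u :: "unit ptree"
    show "PORT_mean (tree_size u) (\<lambda>u. of_bool (k \<le> tree_size u \<and> atypical \<eta> u)) \<le> e * of_bool (k \<le> tree_size u)"
    proof (cases "k \<le> tree_size u")
      case True
      have "PORT_mean (tree_size u) (\<lambda>u. of_bool (k \<le> tree_size u \<and> atypical \<eta> u)) \<le> PORT_prob (tree_size u) (atypical \<eta>)"
        unfolding PORT_prob_def by (intro PORT_mean_mono) simp
      then show ?thesis
        using assms(2)[OF True] True by simp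
    next
      case False
      have "PORT_mean (tree_size u) (\<lambda>v. of_bool (k \<le> tree_size v \<and> atypical \<eta> v)) = PORT_mean (tree_size u) (\<lambda>_. 0)"
        using False by (intro PORT_mean_cong) (simp del: forest_size.simps)
      then show ?thesis
        using False PORT_mean_const[OF tree_size_ge_1, of u 0] by simp
    qed
  qed
  also have "\<dots> = e * PORT_mean n (fringe_count k)"
    by (rule PORT_mean_cmult)
  finally show ?thesis .
qed

lemma finite_bounded_shapes: "finite {T :: unit ptree. tree_size T \<le> n}"
  using small_shapes(1)[of "Suc n"] by (simp add: less_Suc_eq_le del: forest_size.simps)

lemma card_fringe_subtrees_ge_typical:
  assumes "tree_size s = n" "G = {T. tree_size T \<le> n \<and> k \<le> tree_size T \<and> \<not> atypical \<eta> T}"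
  shows "real (card (fringe_subtrees s)) \<ge> fringe_count k s - atypical_count \<eta> k s - repeated_pairs G s"
proof -
  have "finite G"
    unfolding assms(2) by (rule finite_subset[OF _ finite_bounded_shapes[of n]]) auto
  then have "real (card (fringe_subtrees s)) \<ge> fringe_sum (\<lambda>u. of_bool (u \<in> G)) [s] - repeated_pairs G s"
    unfolding repeated_pairs_def by (rule card_fringe_subtrees_ge)
  moreover have "fringe_sum (\<lambda>u. of_bool (u \<in> G)) [s] =
      fringe_sum (\<lambda>u. of_bool (k \<le> tree_size u) - of_bool (k \<le> tree_size u \<and> atypical \<eta> u)) [s]"
    using assms by (intro fringe_sum_cong) (auto simp del: forest_size.simps)
  moreover have "\<dots> = fringe_count k s - atypical_count \<eta> k s"
    unfolding fringe_sum_diff fringe_count_def atypical_count_def ..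
  ultimately show ?thesis by linarith
qed

section \<open>The lower bounds\<close>

lemma lower_tail:
  assumes "c < c13"
  shows "(\<lambda>n. PORT_prob n (\<lambda>s. real (card (fringe_subtrees s)) < c * rate n)) \<longlonglongrightarrow> 0"
proof -
  \<comment> \<open>The maximum with 0 keeps \<open>c'\<close> positive, so that \<open>b\<close>
    makes sense. \<open>\<beta>\<close> lies midway between \<open>2 * c'\<close> and
    \<open>2 * c13\<close>, which gives both \<open>\<beta> < 2 * c13\<close> and
    \<open>\<beta> * b > 1\<close>.\<close>
  define c' where "c' = (max c 0 + c13) / 2"
  define b \<beta> \<delta> where "b = 1 / (2 * c')" and "\<beta> = c' + c13" and "\<delta> = (c' - c) / 2"
  define \<eta> where "\<eta> = (2 * c13 - \<beta>) / 2"
  define k where "k = log_threshold b"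
  define G where "G n = {T :: unit ptree. tree_size T \<le> n \<and> k n \<le> tree_size T \<and> \<not> atypical \<eta> T}" for n
  have c': "0 < c'" "c < c'" "c' < c13"
    using assms c13_pos by (auto simp: c'_def)
  have b: "b > 0" "1 / (2 * b) = c'"
    using c' by (auto simp: b_def)
  have \<beta>: "0 \<le> \<beta>" "\<beta> < 2 * c13" "\<beta> * b > 1"
    using c' by (auto simp: \<beta>_def b_def field_simps)
  have \<delta>: "\<delta> > 0" "c' = c + \<delta> + \<delta>"
    using c' by (auto simp: \<delta>_def)
  have \<eta>: "\<eta> > 0"
    using \<beta> by (simp add: \<eta>_def)
  note count = tendsto_PORT_mean_fringe_count[OF b(1), folded k_def, unfolded b(2)]
  have k_lim: "filterlim k at_top sequentially"
    unfolding filterlim_at_top k_def using eventually_log_threshold_ge[OF b(1)] by blast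

  have atyp: "(\<lambda>n. PORT_mean n (atypical_count \<eta> (k n)) / rate n) \<longlonglongrightarrow> 0"
  proof (rule order_tendstoI)
    fix a :: real assume "a < 0"
    show "\<forall>\<^sub>F n in sequentially. a < PORT_mean n (atypical_count \<eta> (k n)) / rate n"
      using eventually_rate_pos
    proof eventually_elim
      case (elim n)
      then have "PORT_mean n (atypical_count \<eta> (k n)) / rate n \<ge> 0"
        by (intro divide_nonneg_pos PORT_mean_nonneg atypical_count_nonneg)
      then show ?case using \<open>a < 0\<close> by linarith
    qed
  next
    fix a :: real assume a: "a > 0"
    define e where "e = a / (2 * c')"
    have e: "e > 0" "e * (2 * c') = a"
      using a c' by (auto simp: e_def)
    have "\<forall>\<^sub>F n in sequentially. PORT_prob n (atypical \<eta>) < e"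
      using tendsto_PORT_prob_atypical[OF \<eta>] e by (intro order_tendstoD)
    \<comment> \<open>Since \<open>k n\<close> tends to infinity, one bound serves all sizes from
      \<open>k n\<close> on.\<close>
    then have "\<forall>\<^sub>F k in sequentially. \<forall>m\<ge>k. PORT_prob m (atypical \<eta>) < e"
      by (rule eventually_all_ge_at_top)
    then have "\<forall>\<^sub>F n in sequentially. \<forall>m\<ge>k n. PORT_prob m (atypical \<eta>) < e"
      using k_lim by (rule eventually_compose_filterlim)
    moreover have "\<forall>\<^sub>F n in sequentially. PORT_mean n (fringe_count (k n)) / rate n < 2 * c'"
      using c' by (intro order_tendstoD[OF count]) simp
    ultimately show "\<forall>\<^sub>F n in sequentially. PORT_mean n (atypical_count \<eta> (k n)) / rate n < a"
      using eventually_rate_pos eventually_ge_at_top[of 1]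
    proof eventually_elim
      case (elim n)
      have "PORT_mean n (atypical_count \<eta> (k n)) \<le> e * PORT_mean n (fringe_count (k n))"
        using elim e by (intro PORT_mean_atypical_count_le) (auto intro: less_imp_le)
      then have "PORT_mean n (atypical_count \<eta> (k n)) / rate n \<le> e * PORT_mean n (fringe_count (k n)) / rate n"
        using elim(3) by (intro divide_right_mono) linarith+
      also have "\<dots> = e * (PORT_mean n (fringe_count (k n)) / rate n)"
        by simp
      also have "\<dots> < e * (2 * c')"
        using elim(2) e(1) by (rule mult_strict_left_mono)
      finally show ?case
        by (simp only: e(2))
    qed
  qed

  \<comment> \<open>With \<open>q = exp (- \<beta> * k n)\<close> the bound \<open>q * n^2\<close>
    is at most \<open>n\<close> to the power \<open>2 - \<beta> * b < 1\<close>, of smaller order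
    than \<open>rate n\<close>.\<close>
  have rep: "(\<lambda>n. PORT_mean n (repeated_pairs (G n)) / rate n) \<longlonglongrightarrow> 0"
  proof (rule tendsto_sandwich[of "\<lambda>_. 0" _ _ "\<lambda>n. real n powr (2 - \<beta> * b) / rate n"])
    show "\<forall>\<^sub>F n in sequentially. 0 \<le> PORT_mean n (repeated_pairs (G n)) / rate n"
      using eventually_rate_pos
      by eventually_elim (intro divide_nonneg_pos PORT_mean_nonneg repeated_pairs_nonneg)
    have "\<forall>\<^sub>F n in sequentially. \<forall>T. k n \<le> tree_size T \<longrightarrow> \<not> atypical \<eta> T \<longrightarrow>
        shape_prob T \<le> exp (- \<beta> * real (k n))"
      using shape_prob_typical_le[OF \<beta>(1,2) \<eta>_def] k_lim by (rule eventually_compose_filterlim)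
    then show "\<forall>\<^sub>F n in sequentially. PORT_mean n (repeated_pairs (G n)) / rate n \<le> real n powr (2 - \<beta> * b) / rate n"
      using eventually_rate_pos eventually_ge_at_top[of 1]
    proof eventually_elim
      case (elim n)
      have "finite (G n)"
        unfolding G_def by (rule finite_subset[OF _ finite_bounded_shapes[of n]]) auto
      then have "PORT_mean n (repeated_pairs (G n)) \<le> exp (- \<beta> * real (k n)) * (real n)\<^sup>2"
        using elim(1,3) by (intro PORT_mean_repeated_pairs_le) (auto simp: G_def)
      also have "\<dots> \<le> exp (- \<beta> * (b * ln (real n))) * (real n)\<^sup>2"
        using log_threshold_bounds(1)[OF b(1) elim(3)] \<beta>(1)
        by (intro mult_right_mono) (auto simp: k_def mult_left_mono)
      also have "exp (- \<beta> * (b * ln (real n))) = real n powr (- (\<beta> * b))"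
        using elim(3) by (simp add: powr_def)
      also have "(real n)\<^sup>2 = real n powr 2"
        using elim(3) by simp
      also have "real n powr (- (\<beta> * b)) * real n powr 2 = real n powr (2 - \<beta> * b)"
        unfolding powr_add[symmetric] by (simp add: algebra_simps)
      finally show ?case
        using elim(2) by (intro divide_right_mono) linarith+
    qed
    show "(\<lambda>n. real n powr (2 - \<beta> * b) / rate n) \<longlonglongrightarrow> 0"
      using \<beta>(3) by real_asymp
  qed simp

  \<comment> \<open>Of the gap \<open>c' - c = 2 * \<delta>\<close>, one half covers the deviation
    of the count and the other these two losses.\<close>
  define err where "err n s = atypical_count \<eta> (k n) s + repeated_pairs (G n) s" for n s
  have "\<forall>\<^sub>F n in sequentially. PORT_prob n (\<lambda>s. real (card (fringe_subtrees s)) < c * rate n) \<le>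
      PORT_prob n (\<lambda>s. \<bar>fringe_count (k n) s - c' * rate n\<bar> \<ge> \<delta> * rate n)
      + 1 / \<delta> * (PORT_mean n (atypical_count \<eta> (k n)) / rate n + PORT_mean n (repeated_pairs (G n)) / rate n)"
    using eventually_rate_pos
  proof eventually_elim
    case (elim n)
    have pos: "\<delta> * rate n > 0"
      using \<delta>(1) elim by (rule mult_pos_pos)
    have "PORT_prob n (\<lambda>s. real (card (fringe_subtrees s)) < c * rate n) \<le>
        PORT_prob n (\<lambda>s. \<bar>fringe_count (k n) s - c' * rate n\<bar> \<ge> \<delta> * rate n \<or> err n s \<ge> \<delta> * rate n)"
    proof (rule PORT_prob_mono)
      fix s :: "unit ptree"
      assume s: "tree_size s = n" "real (card (fringe_subtrees s)) < c * rate n"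
      have "real (card (fringe_subtrees s)) \<ge> fringe_count (k n) s - err n s"
        using card_fringe_subtrees_ge_typical[OF s(1) G_def] by (simp add: err_def)
      moreover have "c' * rate n = c * rate n + \<delta> * rate n + \<delta> * rate n"
        by (simp only: \<delta>(2) distrib_right)
      ultimately show "\<bar>fringe_count (k n) s - c' * rate n\<bar> \<ge> \<delta> * rate n \<or> err n s \<ge> \<delta> * rate n"
        using s(2) by linarith
    qed
    also have "\<dots> \<le> PORT_prob n (\<lambda>s. \<bar>fringe_count (k n) s - c' * rate n\<bar> \<ge> \<delta> * rate n)
        + PORT_prob n (\<lambda>s. err n s \<ge> \<delta> * rate n)"
      by (rule PORT_prob_disj_le)
    also have "PORT_prob n (\<lambda>s. err n s \<ge> \<delta> * rate n) \<le> PORT_mean n (err n) / (\<delta> * rate n)"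
      using pos by (intro PORT_prob_Markov) (simp_all only: err_def add_nonneg_nonneg atypical_count_nonneg repeated_pairs_nonneg)
    also have "PORT_mean n (err n) = PORT_mean n (atypical_count \<eta> (k n)) + PORT_mean n (repeated_pairs (G n))"
      unfolding err_def[abs_def] by (rule PORT_mean_add)
    also have "(PORT_mean n (atypical_count \<eta> (k n)) + PORT_mean n (repeated_pairs (G n))) / (\<delta> * rate n) =
        1 / \<delta> * (PORT_mean n (atypical_count \<eta> (k n)) / rate n + PORT_mean n (repeated_pairs (G n)) / rate n)"
      by (simp only: add_divide_distrib[symmetric] times_divide_times_eq mult_1_left)
    finally show ?case by simp
  qed
  moreover have "(\<lambda>n. PORT_prob n (\<lambda>s. \<bar>fringe_count (k n) s - c' * rate n\<bar> \<ge> \<delta> * rate n)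
      + 1 / \<delta> * (PORT_mean n (atypical_count \<eta> (k n)) / rate n + PORT_mean n (repeated_pairs (G n)) / rate n))
      \<longlonglongrightarrow> 0 + 1 / \<delta> * (0 + 0)"
    using tendsto_fringe_count_deviation[OF b(1) \<delta>(1), folded k_def, unfolded b(2)]
    by (intro tendsto_add tendsto_mult tendsto_const atyp rep)
  ultimately show ?thesis
    by (intro tendsto_0_nonneg_bound[OF _ _ PORT_prob_nonneg]) simp_all
qed

text \<open>The sequence is chosen as for the Ky Fan metric: \<open>e n\<close> nearly attains the infimum of
  the \<open>x > 0\<close> with \<open>f x n \<le> x\<close>.\<close>

lemma diagonal_null_sequence:
  fixes f :: "real \<Rightarrow> nat \<Rightarrow> real"
  assumes lim: "\<And>x. x > 0 \<Longrightarrow> f x \<longlonglongrightarrow> 0"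
    and nonneg: "\<And>x n. f x n \<ge> 0" and le_1: "\<And>x. \<forall>\<^sub>F n in sequentially. f x n \<le> 1"
  obtains e where "e \<longlonglongrightarrow> 0" "(\<lambda>n. f (e n) n) \<longlonglongrightarrow> 0"
proof -
  define S where "S n = {x. x > 0 \<and> f x n \<le> x}" for n
  define e where "e n = (SOME x. x \<in> S n \<and> x < Inf (S n) + 1 / real (Suc n))" for n
  have bdd: "bdd_below (S n)" for n
    by (rule bdd_belowI[of _ 0]) (simp add: S_def)
  have e: "e n \<in> S n \<and> e n < Inf (S n) + 1 / real (Suc n)" if "S n \<noteq> {}" for n
  proof -
    have "\<exists>x\<in>S n. x < Inf (S n) + 1 / real (Suc n)"
      using that bdd by (simp add: cInf_less_iff[symmetric])
    then show ?thesis
      unfolding e_def by (metis (mono_tags, lifting) someI_ex)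
  qed
  have pos: "\<forall>\<^sub>F n in sequentially. e n > 0 \<and> f (e n) n \<le> e n"
    using le_1[of 1]
  proof eventually_elim
    case (elim n)
    then have "1 \<in> S n" by (simp add: S_def)
    then have "e n \<in> S n"
      using e[of n] by blast
    then show ?case
      by (simp add: S_def)
  qed
  have "e \<longlonglongrightarrow> 0"
  proof (rule order_tendstoI)
    fix a :: real assume "a < 0"
    show "\<forall>\<^sub>F n in sequentially. a < e n"
      using pos by eventually_elim (use \<open>a < 0\<close> in linarith)
  next
    fix a :: real assume "a > 0"
    have "\<forall>\<^sub>F n in sequentially. f (a / 2) n < a / 2"
      using \<open>a > 0\<close> by (intro order_tendstoD[OF lim]) auto
    moreover have "\<forall>\<^sub>F n in sequentially. 1 / real (Suc n) < a / 2"
      using \<open>a > 0\<close> by real_asymp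
    ultimately show "\<forall>\<^sub>F n in sequentially. e n < a"
    proof eventually_elim
      case (elim n)
      then have "a / 2 \<in> S n"
        using \<open>a > 0\<close> by (simp add: S_def)
      then have "Inf (S n) \<le> a / 2" "S n \<noteq> {}"
        using cInf_lower[OF _ bdd] by blast+
      then show ?case
        using e[of n] elim(2) by linarith
    qed
  qed
  moreover have "(\<lambda>n. f (e n) n) \<longlonglongrightarrow> 0"
    by (rule tendsto_0_nonneg_bound[OF \<open>e \<longlonglongrightarrow> 0\<close> _ nonneg]) (use pos in \<open>auto elim: eventually_mono\<close>)
  ultimately show ?thesis ..
qed

lemma smallo_1I:
  fixes f :: "nat \<Rightarrow> real"
  assumes "f \<longlonglongrightarrow> 0"
  shows "f \<in> o(\<lambda>_. 1)"
  using assms by (intro smalloI_tendsto) simp_all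

text \<open>Markov's inequality read backwards: the mean is at least \<open>c' * rate n\<close>
  times the probability of reaching that level, and this probability tends to 1 by the lower
  tail.\<close>

lemma lower_expectation:
  assumes "c < c13"
  shows "\<forall>\<^sub>F n in sequentially. c * rate n \<le> PORT_mean n (\<lambda>s. real (card (fringe_subtrees s)))"
proof (cases "c \<le> 0")
  case True
  show ?thesis
    using eventually_rate_pos
  proof eventually_elim
    case (elim n)
    have "c * rate n \<le> 0"
      using True elim by (intro mult_nonpos_nonneg) linarith+
    also have "0 \<le> PORT_mean n (\<lambda>s. real (card (fringe_subtrees s)))"
      by (rule PORT_mean_nonneg) simp
    finally show ?case .
  qed
next
  case False
  define c' where "c' = (c + c13) / 2"
  have c': "c < c'" "c' < c13" "c' > 0"
    using assms False by (auto simp: c'_def)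
  let ?P = "\<lambda>n. PORT_prob n (\<lambda>s. real (card (fringe_subtrees s)) < c' * rate n)"
  have "(\<lambda>n. c' * (1 - ?P n)) \<longlonglongrightarrow> c' * (1 - 0)"
    by (intro tendsto_mult tendsto_diff tendsto_const lower_tail c')
  then have "\<forall>\<^sub>F n in sequentially. c < c' * (1 - ?P n)"
    using c' by (intro order_tendstoD) simp_all
  then show ?thesis
    using eventually_rate_pos eventually_ge_at_top[of 1]
  proof eventually_elim
    case (elim n)
    have pos: "c' * rate n > 0"
      using c'(3) elim(2) by (rule mult_pos_pos)
    have cancel: "x * (y / x) = y" if "x > 0" for x y :: real
      using that by simp
    have "c * rate n \<le> c' * (1 - ?P n) * rate n"
      using elim(1,2) by (intro mult_right_mono) linarith+
    also have "\<dots> = c' * rate n * PORT_prob n (\<lambda>s. \<not> real (card (fringe_subtrees s)) < c' * rate n)"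
      using elim(3) by (simp only: PORT_prob_not mult_ac)
    also have "\<dots> \<le> c' * rate n * (PORT_mean n (\<lambda>s. real (card (fringe_subtrees s))) / (c' * rate n))"
      using pos unfolding not_less by (intro mult_left_mono PORT_prob_Markov) linarith+
    also have "\<dots> = PORT_mean n (\<lambda>s. real (card (fringe_subtrees s)))"
      by (rule cancel[OF pos])
    finally show ?case .
  qed
qed

section \<open>From fixed constants to null sequences\<close>

lemma expectation_bounds:
  "\<exists>\<epsilon> \<delta> :: nat \<Rightarrow> real. \<epsilon> \<in> o(\<lambda>_. 1) \<and> \<delta> \<in> o(\<lambda>_. 1) \<and>
     (\<forall>\<^sub>F n in sequentially.
        c13 * rate n * (1 + \<epsilon> n) \<le> PORT_mean n (\<lambda>s. real (card (fringe_subtrees s))) \<and>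
        PORT_mean n (\<lambda>s. real (card (fringe_subtrees s))) \<le> c14 * rate n * (1 + \<delta> n))"
proof -
  let ?E = "\<lambda>n. PORT_mean n (\<lambda>s. real (card (fringe_subtrees s)))"
  \<comment> \<open>The actual relative errors, truncated at 0: the inequalities then hold as soon
    as \<open>rate n > 0\<close>, and each sequence has only one side left to estimate.\<close>
  define \<epsilon> \<delta> where "\<epsilon> n = min 0 (?E n / (c13 * rate n) - 1)" and "\<delta> n = max 0 (?E n / (c14 * rate n) - 1)" for n
  have c14: "c14 > 0" by (simp add: c14_def)
  have "\<epsilon> \<longlonglongrightarrow> 0"
  proof (rule order_tendstoI)
    fix a :: real assume a: "a < 0"
    have "\<forall>\<^sub>F n in sequentially. c13 * (1 + a / 2) * rate n \<le> ?E n"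
      using a c13_pos by (intro lower_expectation) simp
    then show "\<forall>\<^sub>F n in sequentially. a < \<epsilon> n"
      using eventually_rate_pos
    proof eventually_elim
      case (elim n)
      have pos: "c13 * rate n > 0"
        using c13_pos elim(2) by (rule mult_pos_pos)
      have "(1 + a / 2) * (c13 * rate n) \<le> ?E n"
        using elim(1) by (simp only: mult_ac)
      then have "1 + a / 2 \<le> ?E n / (c13 * rate n)"
        using pos by (simp only: pos_le_divide_eq)
      then show ?case
        using a unfolding \<epsilon>_def by linarith
    qed
  qed (auto simp: \<epsilon>_def min_less_iff_disj)
  moreover have "\<delta> \<longlonglongrightarrow> 0"
  proof (rule order_tendstoI)
    fix a :: real assume a: "a > 0"
    have "\<forall>\<^sub>F n in sequentially. ?E n \<le> c14 * (1 + a / 2) * rate n"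
      using a c14 by (intro upper_bounds) simp
    then show "\<forall>\<^sub>F n in sequentially. \<delta> n < a"
      using eventually_rate_pos
    proof eventually_elim
      case (elim n)
      have pos: "c14 * rate n > 0"
        using c14 elim(2) by (rule mult_pos_pos)
      have "?E n \<le> (1 + a / 2) * (c14 * rate n)"
        using elim(1) by (simp only: mult_ac)
      then have "?E n / (c14 * rate n) \<le> 1 + a / 2"
        using pos by (simp only: pos_divide_le_eq)
      then show ?case
        using a unfolding \<delta>_def by linarith
    qed
  qed (auto simp: \<delta>_def less_max_iff_disj)
  moreover have "\<forall>\<^sub>F n in sequentially. c13 * rate n * (1 + \<epsilon> n) \<le> ?E n \<and> ?E n \<le> c14 * rate n * (1 + \<delta> n)"
    using eventually_rate_pos
  proof eventually_elim
    case (elim n)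
    have pos: "c13 * rate n > 0" "c14 * rate n > 0"
      using c13_pos c14 elim by (blast intro: mult_pos_pos)+
    have "1 + \<epsilon> n \<le> ?E n / (c13 * rate n)" "?E n / (c14 * rate n) \<le> 1 + \<delta> n"
      unfolding \<epsilon>_def \<delta>_def by linarith+
    then show ?case
      using pos by (simp only: pos_le_divide_eq pos_divide_le_eq mult.commute)
  qed
  ultimately show ?thesis
    by (intro exI[of _ \<epsilon>] exI[of _ \<delta>] conjI smallo_1I)
qed

lemma probability_bounds:
  "\<exists>\<epsilon> \<delta> :: nat \<Rightarrow> real. \<epsilon> \<in> o(\<lambda>_. 1) \<and> \<delta> \<in> o(\<lambda>_. 1) \<and>
     (\<lambda>n. PORT_prob n (\<lambda>s. c13 * rate n * (1 + \<epsilon> n) \<le> real (card (fringe_subtrees s)) \<and>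
        real (card (fringe_subtrees s)) \<le> c14 * rate n * (1 + \<delta> n))) \<longlonglongrightarrow> 1"
proof -
  let ?H = "\<lambda>s. real (card (fringe_subtrees s))"
  define f g where "f x n = PORT_prob n (\<lambda>s. ?H s < c13 * (1 - x) * rate n)"
    and "g x n = PORT_prob n (\<lambda>s. ?H s > c14 * (1 + x) * rate n)" for x n
  have prob_le_1: "\<forall>\<^sub>F n in sequentially. PORT_prob n (Q n) \<le> 1" for Q
    using eventually_ge_at_top[of 1] by eventually_elim (rule PORT_prob_le_1)
  have "f x \<longlonglongrightarrow> 0" if "x > 0" for x
    unfolding f_def using that c13_pos by (intro lower_tail) simp
  moreover have "f x n \<ge> 0" "\<forall>\<^sub>F n in sequentially. f x n \<le> 1" for x n
    unfolding f_def by (rule PORT_prob_nonneg, rule prob_le_1)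
  ultimately obtain d where d: "d \<longlonglongrightarrow> 0" "(\<lambda>n. f (d n) n) \<longlonglongrightarrow> 0"
    by (rule diagonal_null_sequence)
  have "g x \<longlonglongrightarrow> 0" if "x > 0" for x
    unfolding g_def using that by (intro upper_bounds(2)) (simp add: c14_def)
  moreover have "g x n \<ge> 0" "\<forall>\<^sub>F n in sequentially. g x n \<le> 1" for x n
    unfolding g_def by (rule PORT_prob_nonneg, rule prob_le_1)
  ultimately obtain e where e: "e \<longlonglongrightarrow> 0" "(\<lambda>n. g (e n) n) \<longlonglongrightarrow> 0"
    by (rule diagonal_null_sequence)
  let ?Q = "\<lambda>n s. c13 * rate n * (1 + - d n) \<le> ?H s \<and> ?H s \<le> c14 * rate n * (1 + e n)"
  have "\<forall>\<^sub>F n in sequentially. 1 - (f (d n) n + g (e n) n) \<le> PORT_prob n (?Q n)"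
    using eventually_ge_at_top[of 1]
  proof eventually_elim
    case (elim n)
    have "1 - PORT_prob n (?Q n) = PORT_prob n (\<lambda>s. \<not> ?Q n s)"
      using elim by (simp only: PORT_prob_not)
    also have "\<dots> \<le> PORT_prob n (\<lambda>s. ?H s < c13 * (1 - d n) * rate n \<or> ?H s > c14 * (1 + e n) * rate n)"
      by (intro PORT_prob_mono) (simp only: de_Morgan_conj not_le mult_ac diff_conv_add_uminus)
    also have "\<dots> \<le> f (d n) n + g (e n) n"
      unfolding f_def g_def by (rule PORT_prob_disj_le)
    finally show ?case by linarith
  qed
  moreover have "(\<lambda>n. 1 - (f (d n) n + g (e n) n)) \<longlonglongrightarrow> 1 - (0 + 0)"
    by (intro tendsto_diff tendsto_add tendsto_const d e)
  ultimately have "(\<lambda>n. PORT_prob n (?Q n)) \<longlonglongrightarrow> 1"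
    by (intro tendsto_sandwich[OF _ prob_le_1 _ tendsto_const]) simp_all
  moreover have "(\<lambda>n. - d n) \<longlonglongrightarrow> 0"
    using tendsto_minus[OF d(1)] by simp
  ultimately show ?thesis
    using e(1) by (intro exI[of _ "\<lambda>n. - d n"] exI[of _ e] conjI smallo_1I)
qed

theorem theorem14:
  shows
    "(\<exists>\<epsilon> \<delta> :: nat \<Rightarrow> real. \<epsilon> \<in> o(\<lambda>_. 1) \<and> \<delta> \<in> o(\<lambda>_. 1) \<and>
       (\<forall>\<^sub>F n in sequentially.
          c13 * real n / ln (real n) * (1 + \<epsilon> n)
            \<le> measure_pmf.expectation (random_PORT n) (\<lambda>t. real (num_distinct_fringe t)) \<and>
          measure_pmf.expectation (random_PORT n) (\<lambda>t. real (num_distinct_fringe t))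
            \<le> c14 * real n / ln (real n) * (1 + \<delta> n))) \<and>
     (\<exists>\<epsilon> \<delta> :: nat \<Rightarrow> real. \<epsilon> \<in> o(\<lambda>_. 1) \<and> \<delta> \<in> o(\<lambda>_. 1) \<and>
       (\<lambda>n. measure_pmf.prob (random_PORT n)
              {t. c13 * real n / ln (real n) * (1 + \<epsilon> n) \<le> real (num_distinct_fringe t) \<and>
                  real (num_distinct_fringe t) \<le> c14 * real n / ln (real n) * (1 + \<delta> n)})
         \<longlonglongrightarrow> 1)"
proof (intro conjI)
  obtain \<epsilon> \<delta> :: "nat \<Rightarrow> real" where o: "\<epsilon> \<in> o(\<lambda>_. 1)" "\<delta> \<in> o(\<lambda>_. 1)"
    and bounds: "\<forall>\<^sub>F n in sequentially.
        c13 * rate n * (1 + \<epsilon> n) \<le> PORT_mean n (\<lambda>s. real (card (fringe_subtrees s))) \<and>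
        PORT_mean n (\<lambda>s. real (card (fringe_subtrees s))) \<le> c14 * rate n * (1 + \<delta> n)"
    using expectation_bounds by blast
  have "\<forall>\<^sub>F n in sequentially.
          c13 * real n / ln (real n) * (1 + \<epsilon> n)
            \<le> measure_pmf.expectation (random_PORT n) (\<lambda>t. real (num_distinct_fringe t)) \<and>
          measure_pmf.expectation (random_PORT n) (\<lambda>t. real (num_distinct_fringe t))
            \<le> c14 * real n / ln (real n) * (1 + \<delta> n)"
    using bounds eventually_ge_at_top[of 1]
    by eventually_elim (simp only: expectation_random_PORT times_divide_eq_right simp_thms)
  then show "\<exists>\<epsilon> \<delta> :: nat \<Rightarrow> real. \<epsilon> \<in> o(\<lambda>_. 1) \<and> \<delta> \<in> o(\<lambda>_. 1) \<and>
       (\<forall>\<^sub>F n in sequentially.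
          c13 * real n / ln (real n) * (1 + \<epsilon> n)
            \<le> measure_pmf.expectation (random_PORT n) (\<lambda>t. real (num_distinct_fringe t)) \<and>
          measure_pmf.expectation (random_PORT n) (\<lambda>t. real (num_distinct_fringe t))
            \<le> c14 * real n / ln (real n) * (1 + \<delta> n))"
    using o by blast
next
  obtain \<epsilon> \<delta> :: "nat \<Rightarrow> real" where o: "\<epsilon> \<in> o(\<lambda>_. 1)" "\<delta> \<in> o(\<lambda>_. 1)"
    and lim: "(\<lambda>n. PORT_prob n (\<lambda>s. c13 * rate n * (1 + \<epsilon> n) \<le> real (card (fringe_subtrees s)) \<and>
        real (card (fringe_subtrees s)) \<le> c14 * rate n * (1 + \<delta> n))) \<longlonglongrightarrow> 1"
    using probability_bounds by blast
  have "\<forall>\<^sub>F n in sequentially.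
      PORT_prob n (\<lambda>s. c13 * rate n * (1 + \<epsilon> n) \<le> real (card (fringe_subtrees s)) \<and>
        real (card (fringe_subtrees s)) \<le> c14 * rate n * (1 + \<delta> n)) =
      measure_pmf.prob (random_PORT n)
        {t. c13 * real n / ln (real n) * (1 + \<epsilon> n) \<le> real (num_distinct_fringe t) \<and>
            real (num_distinct_fringe t) \<le> c14 * real n / ln (real n) * (1 + \<delta> n)}"
    using eventually_ge_at_top[of 1]
  proof eventually_elim
    case (elim n)
    show ?case
      unfolding times_divide_eq_right
      by (rule prob_random_PORT[OF elim, of "\<lambda>h. c13 * real n / ln (real n) * (1 + \<epsilon> n) \<le> real h \<and>
            real h \<le> c14 * real n / ln (real n) * (1 + \<delta> n)", symmetric])
  qed
  then have "(\<lambda>n. measure_pmf.prob (random_PORT n)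
        {t. c13 * real n / ln (real n) * (1 + \<epsilon> n) \<le> real (num_distinct_fringe t) \<and>
            real (num_distinct_fringe t) \<le> c14 * real n / ln (real n) * (1 + \<delta> n)}) \<longlonglongrightarrow> 1"
    by (rule Lim_transform_eventually[OF lim])
  then show "\<exists>\<epsilon> \<delta> :: nat \<Rightarrow> real. \<epsilon> \<in> o(\<lambda>_. 1) \<and> \<delta> \<in> o(\<lambda>_. 1) \<and>
       (\<lambda>n. measure_pmf.prob (random_PORT n)
              {t. c13 * real n / ln (real n) * (1 + \<epsilon> n) \<le> real (num_distinct_fringe t) \<and>
                  real (num_distinct_fringe t) \<le> c14 * real n / ln (real n) * (1 + \<delta> n)})
         \<longlonglongrightarrow> 1"
    using o by blast
qed

end
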